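(* Let $\theta$ be a primitive, aperiodic, bijective, simplified substitution. Then the structural semigroup $\mathcal M^{fib}_0(X_\theta)$ of $\theta$ is isomorphic to the matrix semigroup $M[G_\theta;I_\theta,\{\pm\};A]$, where $G_\theta$ is the structure group and $I_\theta$ the R-set of $\theta$, and $A=(a_{\lambda g})_{\lambda\in\{\pm\},g\in I_\theta}$ is given, for a fixed $g_0\in I_\theta$, by $a_{+\,g}=\mathbf 1$ and $a_{-\,g}=g_0g^{-1}$.
   Context: Let $\mathcal A$ be a finite alphabet. A substitution of length $\ell$ is a map $\theta(a)=\theta_0(a)\cdots\theta_{\ell-1}(a)$ with maps $\theta_i:\mathcal A\to\mathcal A$, extended by concatenation to finite words and to bi-infinite sequences ($\theta(u_0)$ being placed starting at index $0$). It is bijective if all $\theta_i$ are bijections, and primitive if for some $k$ every $\theta^k(a)$ contains every letter. Write $\theta^n(a)=(\theta^n)_0(a)\cdots(\theta^n)_{\ell^n-1}(a)$. A word is allowed if it occurs in some $\theta^k(a)$; $X_\theta\subset\mathcal A^{\mathbb Z}$ is the space of sequences all of whose finite subwords are allowed, with left shift $\sigma$. $\theta$ is aperiodic if $X_\theta$ contains no $\sigma$-periodic sequence. A bijective $\theta$ is simplified if every $\theta$-periodic point of $X_\theta$ is fixed by $\theta$ (in particular $\theta_0=\theta_{\ell-1}=\mathbf 1$) and every word $\theta(a)$ contains all letters of $\mathcal A$. $\mathbb Z_\ell=\varprojlim\mathbb Z/\ell^n\mathbb Z$. For each $n$ the sets $\sigma^i(\theta^n(X_\theta))$, $0\le i<\ell^n$,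 partition $X_\theta$; put $\pi_n(x)=i$ if $x\in\sigma^i(\theta^n(X_\theta))$. The $\pi_n$ define the equicontinuous factor map $\pi:X_\theta\to\mathbb Z_\ell$, $\pi\circ\sigma=(+1)\circ\pi$. The Ellis semigroup $E(X_\theta)$ is the closure of $\{\sigma^t:t\in\mathbb Z\}$ in $X_\theta^{X_\theta}$ (pointwise convergence, composition). $E^{fib}(X_\theta)$ is the subsemigroup of elements preserving all fibres $\pi^{-1}(z)$, $E^{fib}_0(X_\theta)$ its restriction to $\pi^{-1}(0)$, and the structural semigroup $\mathcal M^{fib}_0(X_\theta)$ is the kernel (smallest two-sided ideal) of $E^{fib}_0(X_\theta)$. $G_\theta$ is the group of permutations of $\mathcal A$ generated by all $(\theta^n)_i$, $n\in\mathbb N$, $0\le i\le\ell^n-1$; the R-set is $I_\theta=\{(\theta^n)_i(\theta^n)_{i-1}^{-1}: n\in\mathbb N, 1\le i\le\ell^n-1\}$. The identity is $\mathbf 1$. $M[G;I,\Lambda;A]$ denotes $I\times G\times\Lambda$ with product $(i,g,\lambda)(j,h,\mu)=(i,g\,a_{\lambda j}h,\mu)$. *)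

theory Defs
  imports
    "HOL-Library.Sublist"
    "HOL-Analysis.Function_Topology"
    "HOL-Algebra.Bij"
    "HOL-Algebra.Elementary_Groups"
begin

section \<open>Substitutions of constant length\<close>

definition has_length :: "('a \<Rightarrow> 'a list) \<Rightarrow> nat \<Rightarrow> bool" where
  "has_length \<theta> l \<longleftrightarrow> (\<forall>a. length (\<theta> a) = l)"

definition subst_word :: "('a \<Rightarrow> 'a list) \<Rightarrow> 'a list \<Rightarrow> 'a list" where
  "subst_word \<theta> w = concat (map \<theta> w)"

definition subst_pow :: "('a \<Rightarrow> 'a list) \<Rightarrow> nat \<Rightarrow> 'a \<Rightarrow> 'a list" where
  "subst_pow \<theta> n a = (subst_word \<theta> ^^ n) [a]"

text \<open>\<open>col \<theta> n i\<close> is the map $(\theta^n)_i$, meaningful for $i < l^n$.\<close>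

definition col :: "('a \<Rightarrow> 'a list) \<Rightarrow> nat \<Rightarrow> nat \<Rightarrow> 'a \<Rightarrow> 'a" where
  "col \<theta> n i = (\<lambda>a. subst_pow \<theta> n a ! i)"

text \<open>The extension to bi-infinite sequences, with $\theta(u_0)$ starting at index 0; \<open>div\<close> and
  \<open>mod\<close> on \<open>int\<close> round towards minus infinity, so this is also right at negative indices.\<close>

definition subst_seq :: "('a \<Rightarrow> 'a list) \<Rightarrow> nat \<Rightarrow> (int \<Rightarrow> 'a) \<Rightarrow> (int \<Rightarrow> 'a)" where
  "subst_seq \<theta> l u = (\<lambda>k. \<theta> (u (k div int l)) ! nat (k mod int l))"

definition bijective_subst :: "('a \<Rightarrow> 'a list) \<Rightarrow> nat \<Rightarrow> bool" where
  "bijective_subst \<theta> l \<longleftrightarrow> (\<forall>i<l. bij (\<lambda>a. \<theta> a ! i))"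

definition primitive_subst :: "('a \<Rightarrow> 'a list) \<Rightarrow> bool" where
  "primitive_subst \<theta> \<longleftrightarrow> (\<exists>k>0. \<forall>a b. b \<in> set (subst_pow \<theta> k a))"

definition allowed :: "('a \<Rightarrow> 'a list) \<Rightarrow> 'a list \<Rightarrow> bool" where
  "allowed \<theta> w \<longleftrightarrow> (\<exists>k a. sublist w (subst_pow \<theta> k a))"

definition subshift :: "('a \<Rightarrow> 'a list) \<Rightarrow> (int \<Rightarrow> 'a) set" where
  "subshift \<theta> = {x. \<forall>i n. allowed \<theta> (map (\<lambda>j. x (i + int j)) [0..<n])}"

text \<open>\<open>shift t\<close> is the power $\sigma^t$ of the left shift.\<close>

definition shift :: "int \<Rightarrow> (int \<Rightarrow> 'a) \<Rightarrow> (int \<Rightarrow> 'a)" where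
  "shift t x = (\<lambda>k. x (k + t))"

definition aperiodic_subst :: "('a \<Rightarrow> 'a list) \<Rightarrow> bool" where
  "aperiodic_subst \<theta> \<longleftrightarrow> \<not> (\<exists>x\<in>subshift \<theta>. \<exists>p>0. shift p x = x)"

definition simplified_subst :: "('a \<Rightarrow> 'a list) \<Rightarrow> nat \<Rightarrow> bool" where
  "simplified_subst \<theta> l \<longleftrightarrow>
     (\<forall>x\<in>subshift \<theta>. (\<exists>p>0. (subst_seq \<theta> l ^^ p) x = x) \<longrightarrow> subst_seq \<theta> l x = x) \<and>
     (\<forall>a b. b \<in> set (\<theta> a))"

section \<open>The equicontinuous factor\<close>

text \<open>The inverse limit of the $\mathbb{Z}/l^n\mathbb{Z}$, as compatible sequences of least
  nonnegative residues.\<close>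

definition l_adic :: "nat \<Rightarrow> (nat \<Rightarrow> nat) set" where
  "l_adic l = {z. \<forall>n. z n < l ^ n \<and> z (Suc n) mod l ^ n = z n}"

text \<open>The description operator is justified because, for primitive aperiodic \<open>\<theta>\<close>, the sets
  $\sigma^i(\theta^n(X_\theta))$ with $0 \le i < l^n$ partition $X_\theta$.\<close>

definition factor_level :: "('a \<Rightarrow> 'a list) \<Rightarrow> nat \<Rightarrow> nat \<Rightarrow> (int \<Rightarrow> 'a) \<Rightarrow> nat" where
  "factor_level \<theta> l n x =
     (THE i. i < l ^ n \<and> x \<in> shift (int i) ` (subst_seq \<theta> l ^^ n) ` subshift \<theta>)"

definition factor_map :: "('a \<Rightarrow> 'a list) \<Rightarrow> nat \<Rightarrow> (int \<Rightarrow> 'a) \<Rightarrow> (nat \<Rightarrow> nat)" where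
  "factor_map \<theta> l x = (\<lambda>n. factor_level \<theta> l n x)"

definition fibre :: "('a \<Rightarrow> 'a list) \<Rightarrow> nat \<Rightarrow> (nat \<Rightarrow> nat) \<Rightarrow> (int \<Rightarrow> 'a) set" where
  "fibre \<theta> l z = {x \<in> subshift \<theta>. factor_map \<theta> l x = z}"

abbreviation zero_fibre :: "('a \<Rightarrow> 'a list) \<Rightarrow> nat \<Rightarrow> (int \<Rightarrow> 'a) set" where
  "zero_fibre \<theta> l \<equiv> fibre \<theta> l (\<lambda>_. 0)"

section \<open>Semigroups given by a carrier set and a product\<close>

definition semigroup_on :: "'s set \<Rightarrow> ('s \<Rightarrow> 's \<Rightarrow> 's) \<Rightarrow> bool" where
  "semigroup_on S m \<longleftrightarrow>
     (\<forall>x\<in>S. \<forall>y\<in>S. m x y \<in> S) \<and>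
     (\<forall>x\<in>S. \<forall>y\<in>S. \<forall>z\<in>S. m (m x y) z = m x (m y z))"

definition semigroup_isomorphic ::
    "'s set \<Rightarrow> ('s \<Rightarrow> 's \<Rightarrow> 's) \<Rightarrow> 't set \<Rightarrow> ('t \<Rightarrow> 't \<Rightarrow> 't) \<Rightarrow> bool" where
  "semigroup_isomorphic S m T m' \<longleftrightarrow>
     semigroup_on S m \<and> semigroup_on T m' \<and>
     (\<exists>h. bij_betw h S T \<and> (\<forall>x\<in>S. \<forall>y\<in>S. h (m x y) = m' (h x) (h y)))"

definition two_sided_ideal :: "'s set \<Rightarrow> ('s \<Rightarrow> 's \<Rightarrow> 's) \<Rightarrow> 's set \<Rightarrow> bool" where
  "two_sided_ideal S m J \<longleftrightarrow>
     J \<subseteq> S \<and> J \<noteq> {} \<and> (\<forall>s\<in>S. \<forall>x\<in>J. m s x \<in> J \<and> m x s \<in> J)"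

text \<open>The order on sets is inclusion, so this is the smallest two-sided ideal, when there is one.\<close>

definition semigroup_kernel :: "'s set \<Rightarrow> ('s \<Rightarrow> 's \<Rightarrow> 's) \<Rightarrow> 's set" where
  "semigroup_kernel S m = (LEAST J. two_sided_ideal S m J)"

section \<open>The Ellis semigroup and the structural semigroup\<close>

definition subshift_topology :: "('a \<Rightarrow> 'a list) \<Rightarrow> (int \<Rightarrow> 'a) topology" where
  "subshift_topology \<theta> =
     subtopology (product_topology (\<lambda>_. discrete_topology UNIV) UNIV) (subshift \<theta>)"

text \<open>Self-maps of $X_\theta$ are the functions in \<open>subshift \<theta> \<rightarrow>\<^sub>E subshift \<theta>\<close>, which is the
  underlying set of the product topology below; their composition is \<open>compose (subshift \<theta>)\<close>.\<close>

definition ellis :: "('a \<Rightarrow> 'a list) \<Rightarrow> ((int \<Rightarrow> 'a) \<Rightarrow> (int \<Rightarrow> 'a)) set" where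
  "ellis \<theta> =
     product_topology (\<lambda>_. subshift_topology \<theta>) (subshift \<theta>) closure_of
       range (\<lambda>t. restrict (shift t) (subshift \<theta>))"

definition ellis_fib :: "('a \<Rightarrow> 'a list) \<Rightarrow> nat \<Rightarrow> ((int \<Rightarrow> 'a) \<Rightarrow> (int \<Rightarrow> 'a)) set" where
  "ellis_fib \<theta> l = {f \<in> ellis \<theta>. \<forall>z\<in>l_adic l. f ` fibre \<theta> l z \<subseteq> fibre \<theta> l z}"

definition ellis_fib0 :: "('a \<Rightarrow> 'a list) \<Rightarrow> nat \<Rightarrow> ((int \<Rightarrow> 'a) \<Rightarrow> (int \<Rightarrow> 'a)) set" where
  "ellis_fib0 \<theta> l = (\<lambda>f. restrict f (zero_fibre \<theta> l)) ` ellis_fib \<theta> l"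

definition structural_semigroup ::
    "('a \<Rightarrow> 'a list) \<Rightarrow> nat \<Rightarrow> ((int \<Rightarrow> 'a) \<Rightarrow> (int \<Rightarrow> 'a)) set" where
  "structural_semigroup \<theta> l = semigroup_kernel (ellis_fib0 \<theta> l) (compose (zero_fibre \<theta> l))"

section \<open>Structure group, R-set and matrix semigroups\<close>

definition structure_group :: "('a \<Rightarrow> 'a list) \<Rightarrow> nat \<Rightarrow> ('a \<Rightarrow> 'a) monoid" where
  "structure_group \<theta> l = subgroup_generated (BijGroup UNIV) {col \<theta> n i |n i. i < l ^ n}"

text \<open>\<open>inv_into UNIV\<close> is the inverse function; its short form \<open>inv\<close> is taken by HOL-Algebra.\<close>

definition R_set :: "('a \<Rightarrow> 'a list) \<Rightarrow> nat \<Rightarrow> ('a \<Rightarrow> 'a) set" where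
  "R_set \<theta> l =
     {col \<theta> n i \<circ> inv_into UNIV (col \<theta> n (i - 1)) |n i. 1 \<le> i \<and> i < l ^ n}"

definition matrix_carrier ::
    "('g, 'b) monoid_scheme \<Rightarrow> 'i set \<Rightarrow> 'l set \<Rightarrow> ('i \<times> 'g \<times> 'l) set" where
  "matrix_carrier G I L = I \<times> carrier G \<times> L"

definition matrix_mult ::
    "('g, 'b) monoid_scheme \<Rightarrow> ('l \<Rightarrow> 'i \<Rightarrow> 'g) \<Rightarrow>
     'i \<times> 'g \<times> 'l \<Rightarrow> 'i \<times> 'g \<times> 'l \<Rightarrow> 'i \<times> 'g \<times> 'l" where
  "matrix_mult G A = (\<lambda>(i, g, r) (j, h, s). (i, g \<otimes>\<^bsub>G\<^esub> A r j \<otimes>\<^bsub>G\<^esub> h, s))"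

datatype sign = Plus | Minus

fun sandwich :: "('g, 'b) monoid_scheme \<Rightarrow> 'g \<Rightarrow> sign \<Rightarrow> 'g \<Rightarrow> 'g" where
  "sandwich G g0 Plus g = \<one>\<^bsub>G\<^esub>"
| "sandwich G g0 Minus g = g0 \<otimes>\<^bsub>G\<^esub> inv\<^bsub>G\<^esub> g"

end

theory Submission imports Defs begin

text \<open>
  By bijectivity every letter of \<open>\<theta>\<^sup>n(y)\<close> determines the letter of \<open>y\<close> it comes from, so recognizability
  is elementary: two different cuttings of the same point would make each letter a fixed permutation
  of its left neighbour, hence the point periodic. Since \<open>\<theta>\<^sub>0\<close> and \<open>\<theta>\<^bsub>l-1\<^esub>\<close> are trivial, the zero fibre
  consists of the fixed points of \<open>\<theta>\<close>, and these are in bijection with the allowed two-letter words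
  \<open>x\<^bsub>-1\<^esub>x\<^sub>0\<close>, that is, with the words \<open>(g\<^sup>-\<^sup>1 b) b\<close> where \<open>g\<close> is in the R-set. Fibre preserving
  elements of the Ellis semigroup act on the zero fibre by replacing \<open>x\<^bsub>-1\<^esub>x\<^sub>0\<close> by \<open>x\<^bsub>s-1\<^esub>x\<^sub>s\<close> for an integer \<open>s\<close>.
  For \<open>s > 0\<close> the new word depends on \<open>x\<^sub>0\<close> only, for \<open>s < 0\<close> on \<open>x\<^bsub>-1\<^esub>\<close> only, which is the sign in the
  matrix semigroup; writing the new word as \<open>(g\<^sup>-\<^sup>1 k x\<^sub>0) (k x\<^sub>0)\<close>, respectively
  \<open>(g\<^sup>-\<^sup>1 k g\<^sub>0 x\<^bsub>-1\<^esub>) (k g\<^sub>0 x\<^bsub>-1\<^esub>)\<close>, gives exactly the stated sandwich matrix. The case \<open>s = 0\<close> is the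
  identity, and the remaining elements form a completely simple ideal, which is therefore the kernel.
\<close>

section \<open>Columns and desubstitution\<close>

locale bijective_substitution =
  fixes \<theta> :: "'a::finite \<Rightarrow> 'a list" and l :: nat
  assumes len: "length (\<theta> a) = l"
    and bij_letter: "i < l \<Longrightarrow> bij (\<lambda>a. \<theta> a ! i)"
    and l_ge_2: "2 \<le> l"
begin

abbreviation "S \<equiv> subst_seq \<theta> l"
abbreviation "X \<equiv> subshift \<theta>"

lemma l_pos: "0 < l" "0 < l ^ n"
  using l_ge_2 by auto

lemma length_subst_word: "length (subst_word \<theta> w) = l * length w"
  by (induction w) (auto simp: subst_word_def len)

lemma nth_subst_word:
  "i < l * length w \<Longrightarrow> subst_word \<theta> w ! i = \<theta> (w ! (i div l)) ! (i mod l)"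
proof (induction w arbitrary: i)
  case (Cons a w)
  show ?case
  proof (cases "i < l")
    case True
    then show ?thesis by (simp add: subst_word_def nth_append len)
  next
    case False
    then have "i div l = Suc ((i - l) div l)" "i mod l = (i - l) mod l"
      using l_pos by (auto simp: le_div_geq le_mod_geq)
    with False Cons show ?thesis
      by (simp add: subst_word_def nth_append len)
  qed
qed simp

lemma length_subst_pow: "length (subst_pow \<theta> n a) = l ^ n"
  by (induction n) (auto simp: subst_pow_def length_subst_word)

lemma col_0: "col \<theta> 0 0 a = a"
  by (simp add: col_def subst_pow_def)

lemma col_Suc:
  assumes "i < l ^ Suc n"
  shows "col \<theta> (Suc n) i a = \<theta> (col \<theta> n (i div l) a) ! (i mod l)"
  using assms nth_subst_word[of i "subst_pow \<theta> n a"] length_subst_pow[of n a]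
  by (simp add: col_def subst_pow_def)

lemma bij_col: "i < l ^ n \<Longrightarrow> bij (col \<theta> n i)"
proof (induction n arbitrary: i)
  case 0
  then have "col \<theta> 0 i = id" by (auto simp: col_0)
  then show ?case by (simp add: bij_id del: id_apply)
next
  case (Suc n)
  have "i div l < l ^ n"
    using Suc.prems l_pos by (simp add: less_mult_imp_div_less mult.commute)
  moreover have "bij (\<lambda>a. \<theta> a ! (i mod l))"
    using bij_letter l_pos by simp
  moreover have "col \<theta> (Suc n) i = (\<lambda>a. \<theta> a ! (i mod l)) \<circ> col \<theta> n (i div l)"
    using col_Suc Suc.prems by auto
  ultimately show ?case
    using Suc.IH bij_comp by metis
qed

lemma subst_seq_at: "r < l \<Longrightarrow> S u (int l * q + int r) = \<theta> (u q) ! r"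
  by (simp add: subst_seq_def)

lemma subst_seq_pow_at:
  "j < l ^ n \<Longrightarrow> (S ^^ n) u (int (l ^ n) * q + int j) = col \<theta> n j (u q)"
proof (induction n arbitrary: j)
  case 0
  then show ?case by (simp add: col_0)
next
  case (Suc n)
  have j: "j div l < l ^ n"
    using Suc.prems l_pos by (simp add: less_mult_imp_div_less mult.commute)
  have "int j = int l * int (j div l) + int (j mod l)"
    by (metis mult_div_mod_eq of_nat_add of_nat_mult)
  then have "int (l ^ Suc n) * q + int j
      = int l * (int (l ^ n) * q + int (j div l)) + int (j mod l)"
    by (simp add: algebra_simps)
  then show ?case
    using subst_seq_at[of "j mod l"] Suc.IH[OF j] l_pos col_Suc[OF Suc.prems] by simp
qed

lemma int_decompose:
  obtains q j where "j < l ^ n" "k = int (l ^ n) * q + int j"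
proof
  show "nat (k mod int (l ^ n)) < l ^ n"
    using l_pos(2)[of n] by (simp add: nat_less_iff del: of_nat_power)
  show "k = int (l ^ n) * (k div int (l ^ n)) + int (nat (k mod int (l ^ n)))"
    using l_pos(2)[of n] by (simp del: of_nat_power)
qed

lemma subst_seq_decompose:
  obtains q r where "r < l" "k = int l * q + int r"
proof -
  from int_decompose[of 1 k] obtain q r where "r < l ^ 1" "k = int (l ^ 1) * q + int r" .
  then show thesis using that by simp
qed

lemma col_index_less:
  assumes "i < l ^ n" "j < l ^ m"
  shows "l ^ m * i + j < l ^ (m + n)"
proof -
  have "l ^ m * i + j < l ^ m * Suc i"
    using assms by simp
  also have "\<dots> \<le> l ^ m * l ^ n"
    using assms by (intro mult_left_mono) auto
  finally show ?thesis
    by (simp add: power_add)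
qed

text \<open>Evaluating \<open>S ^^ (m + n)\<close> on a constant sequence reduces this to
  \<open>subst_seq_pow_at\<close>: block \<open>i\<close> of length \<open>l ^ m\<close> comes from
  letter \<open>i\<close> of the word of level \<open>n\<close>.\<close>

lemma col_add:
  assumes "i < l ^ n" "j < l ^ m"
  shows "col \<theta> (m + n) (l ^ m * i + j) = col \<theta> m j \<circ> col \<theta> n i"
proof
  fix a
  have "col \<theta> (m + n) (l ^ m * i + j) a = (S ^^ (m + n)) (\<lambda>_. a) (int (l ^ m * i + j))"
    using col_index_less[OF assms] subst_seq_pow_at[of "l ^ m * i + j" "m + n" "\<lambda>_. a" 0] by simp
  also have "\<dots> = (S ^^ m) ((S ^^ n) (\<lambda>_. a)) (int (l ^ m) * int i + int j)"
    by (simp add: funpow_add)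
  also have "\<dots> = col \<theta> m j ((S ^^ n) (\<lambda>_. a) (int i))"
    using assms subst_seq_pow_at by blast
  also have "(S ^^ n) (\<lambda>_. a) (int i) = col \<theta> n i a"
    using assms subst_seq_pow_at[of i n "\<lambda>_. a" 0] by simp
  finally show "col \<theta> (m + n) (l ^ m * i + j) a = (col \<theta> m j \<circ> col \<theta> n i) a"
    by simp
qed

section \<open>Shifts, allowed windows and the subshift\<close>

lemma subst_seq_shift: "S (shift t u) = shift (int l * t) (S u)"
proof
  fix k
  obtain q r where *: "r < l" "k = int l * q + int r" using subst_seq_decompose .
  have "k + int l * t = int l * (q + t) + int r"
    by (simp add: * algebra_simps)
  then show "S (shift t u) k = shift (int l * t) (S u) k"
    using subst_seq_at[OF *(1), of u "q + t"] subst_seq_at[OF *(1), of "shift t u" q]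
    by (simp add: shift_def * algebra_simps)
qed

lemma subst_seq_pow_shift: "(S ^^ n) (shift t u) = shift (int (l ^ n) * t) ((S ^^ n) u)"
proof (induction n)
  case (Suc n)
  then show ?case
    by (simp add: subst_seq_shift mult.assoc)
qed (simp add: shift_def)

lemma shift_shift: "shift s (shift t u) = shift (s + t) u"
  by (simp add: shift_def add.assoc)

text \<open>An indexed form of \<open>allowed\<close> for the window of length \<open>n\<close>
  starting at \<open>i\<close>. Recording an occurrence by its position \<open>p\<close> lets
  windows be restricted and substituted by index arithmetic alone.\<close>

definition admits :: "(int \<Rightarrow> 'a) \<Rightarrow> int \<Rightarrow> nat \<Rightarrow> bool" where
  "admits x i n \<longleftrightarrow>
     (\<exists>k a p. p + n \<le> l ^ k \<and> (\<forall>j<n. x (i + int j) = col \<theta> k (p + j) a))"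

lemma admits_iff_allowed: "admits x i n \<longleftrightarrow> allowed \<theta> (map (\<lambda>j. x (i + int j)) [0..<n])"
proof
  assume "admits x i n"
  then obtain k a p where *: "p + n \<le> l ^ k" "\<forall>j<n. x (i + int j) = col \<theta> k (p + j) a"
    by (auto simp: admits_def)
  then have "map (\<lambda>j. x (i + int j)) [0..<n] = take n (drop p (subst_pow \<theta> k a))"
    by (intro nth_equalityI) (auto simp: length_subst_pow col_def)
  then show "allowed \<theta> (map (\<lambda>j. x (i + int j)) [0..<n])"
    unfolding allowed_def by (metis sublist_drop sublist_take sublist_order.order_trans)
next
  assume "allowed \<theta> (map (\<lambda>j. x (i + int j)) [0..<n])"
  then obtain k a u v where *: "subst_pow \<theta> k a = u @ map (\<lambda>j. x (i + int j)) [0..<n] @ v"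
    by (auto simp: allowed_def sublist_def)
  from arg_cong[OF this, of length] have "length u + n \<le> l ^ k"
    by (simp add: length_subst_pow)
  moreover have "x (i + int j) = col \<theta> k (length u + j) a" if "j < n" for j
    using that by (simp add: col_def * nth_append)
  ultimately show "admits x i n"
    unfolding admits_def by blast
qed

lemma subshift_iff: "x \<in> X \<longleftrightarrow> (\<forall>i n. admits x i n)"
  by (simp add: subshift_def admits_iff_allowed)

lemma admits_mono:
  assumes "admits x i n" "i \<le> i'" "i' + int n' \<le> i + int n"
  shows "admits x i' n'"
proof -
  obtain k a p where *: "p + n \<le> l ^ k" "\<forall>j<n. x (i + int j) = col \<theta> k (p + j) a"
    using assms by (auto simp: admits_def)
  define d where "d = nat (i' - i)"
  have d: "i' = i + int d" "d + n' \<le> n"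
    using assms by (auto simp: d_def)
  have "x (i' + int j) = col \<theta> k (p + d + j) a" if "j < n'" for j
    using *(2)[rule_format, of "d + j"] d that by (simp add: add.assoc)
  moreover have "p + d + n' \<le> l ^ k"
    using * d by simp
  ultimately show ?thesis
    unfolding admits_def by blast
qed

lemma subshift_iff_symmetric: "x \<in> X \<longleftrightarrow> (\<forall>N. admits x (- int N) (2 * N))"
proof -
  have "admits x i n" if "\<forall>N. admits x (- int N) (2 * N)" for i n
    using that[rule_format, of "nat \<bar>i\<bar> + n"] by (rule admits_mono) auto
  then show ?thesis
    by (auto simp: subshift_iff)
qed

lemma admits_cong:
  "(\<And>j. i \<le> j \<Longrightarrow> j < i + int n \<Longrightarrow> x j = y j) \<Longrightarrow> admits x i n \<longleftrightarrow> admits y i n"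
  by (simp add: admits_def)

lemma admits_subst_seq:
  assumes "admits x i n"
  shows "admits (S x) (int l * i) (l * n)"
proof -
  obtain k a p where *: "p + n \<le> l ^ k" "\<forall>j<n. x (i + int j) = col \<theta> k (p + j) a"
    using assms by (auto simp: admits_def)
  have bound: "l * p + l * n \<le> l ^ Suc k"
    using * by (metis add_mult_distrib2 mult_le_mono2 power_Suc)
  have "S x (int l * i + int j) = col \<theta> (Suc k) (l * p + j) a" if "j < l * n" for j
  proof -
    have j: "j div l < n" 
      using that l_pos by (simp add: less_mult_imp_div_less mult.commute)
    have "int j = int l * int (j div l) + int (j mod l)"
      by (metis mult_div_mod_eq of_nat_add of_nat_mult)
    then have "int l * i + int j = int l * (i + int (j div l)) + int (j mod l)"
      by (simp add: algebra_simps)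
    then have "S x (int l * i + int j) = \<theta> (x (i + int (j div l))) ! (j mod l)"
      using subst_seq_at l_pos by simp
    also have "\<dots> = \<theta> (col \<theta> k (p + j div l) a) ! (j mod l)"
      using * j by simp
    also have "\<dots> = col \<theta> (Suc k) (l * p + j) a"
      using col_Suc[of "l * p + j"] that bound l_pos by simp
    finally show ?thesis .
  qed
  then show ?thesis
    unfolding admits_def using bound by blast
qed

lemma shift_in_subshift:
  assumes "x \<in> X"
  shows "shift t x \<in> X"
proof -
  have "admits (shift t x) i n" for i n
    using assms[unfolded subshift_iff, rule_format, of "t + i" n]
    by (simp add: admits_def shift_def algebra_simps)
  then show ?thesis
    by (simp add: subshift_iff)
qed

text \<open>The cutting points of \<open>x\<close> read off from longer and longer windows form a decreasing family of
  nonempty sets of residues, and bijectivity recovers the preimage from one letter of each block.\<close>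

lemma desubstitute:
  assumes "x \<in> X"
  shows "\<exists>i<l. x \<in> shift (int i) ` S ` X"
proof -
  \<comment> \<open>The window from \<open>- N\<close> to \<open>N - 1\<close> occurs in a word of
    level at least one, with the origin at offset \<open>i\<close> inside a block of length
    \<open>l\<close>.\<close>
  define P where "P i N \<longleftrightarrow> (\<exists>k a p. (p + N) mod l = i \<and> p + 2 * N \<le> l ^ Suc k \<and>
      (\<forall>j<2 * N. x (- int N + int j) = col \<theta> (Suc k) (p + j) a))" for i N
  have ex: "\<exists>i<l. P i N" for N
  proof -
    \<comment> \<open>One extra letter on each side makes the length at least two, which excludes
      \<open>k = 0\<close> even when \<open>N = 0\<close>.\<close>
    have "admits x (- int (Suc N)) (2 * Suc N)"
      using assms subshift_iff_symmetric by blast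
    then obtain k a p where *: "p + 2 * Suc N \<le> l ^ k"
      "\<And>j. j < 2 * Suc N \<Longrightarrow> x (- int (Suc N) + int j) = col \<theta> k (p + j) a"
      unfolding admits_def by blast
    obtain k' where k': "k = Suc k'"
      using * by (cases k) auto
    have "x (- int N + int j) = col \<theta> (Suc k') (Suc p + j) a" if "j < 2 * N" for j
      using *(2)[of "Suc j"] that k' by simp
    moreover have "Suc p + 2 * N \<le> l ^ Suc k'"
      using * k' by simp
    ultimately have "P ((Suc p + N) mod l) N"
      unfolding P_def by blast
    then show ?thesis
      using l_pos mod_less_divisor by blast
  qed
  have anti: "P i N" if PM: "P i M" and NM: "N \<le> M" for i N M
  proof -
    obtain k a p where *: "(p + M) mod l = i" "p + 2 * M \<le> l ^ Suc k"
      "\<And>j. j < 2 * M \<Longrightarrow> x (- int M + int j) = col \<theta> (Suc k) (p + j) a"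
      using PM unfolding P_def by blast
    have "x (- int N + int j) = col \<theta> (Suc k) (p + (M - N) + j) a" if "j < 2 * N" for j
      using *(3)[of "M - N + j"] that NM by (simp add: add.assoc)
    then show ?thesis
      unfolding P_def using *(1,2) NM
      by (intro exI[of _ k] exI[of _ a] exI[of _ "p + (M - N)"]) auto
  qed
  have "\<exists>i<l. \<forall>N. P i N"
  proof (rule ccontr)
    assume "\<not> ?thesis"
    then obtain F where F: "\<And>i. i < l \<Longrightarrow> \<not> P i (F i)" by metis
    \<comment> \<open>The sum bounds every \<open>F i\<close>, so a single window size refutes all
      residues at once.\<close>
    obtain i where "i < l" "P i (\<Sum>i<l. F i)" using ex by blast
    moreover have "F i \<le> (\<Sum>i<l. F i)"
      using \<open>i < l\<close> by (intro member_le_sum) auto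
    ultimately show False using F anti by blast
  qed
  then obtain i where i: "i < l" "\<And>N. P i N" by blast
  \<comment> \<open>Block \<open>q\<close> starts at index \<open>l q - i\<close> of
    \<open>x\<close>, and its first letter determines the letter it comes from.\<close>
  define y where "y q = inv_into UNIV (\<lambda>a. \<theta> a ! 0) (x (int l * q - int i))" for q
  \<comment> \<open>One word serves all blocks near the origin; \<open>e\<close> is the index of the
    letter whose image contains the origin. Both the block equation and the allowed windows of
    \<open>y\<close> follow from this.\<close>
  have y: "\<exists>k a e. N \<le> e \<and> e + N \<le> l ^ k \<and>
      (\<forall>q r. - int N \<le> q \<longrightarrow> q < int N \<longrightarrow> r < l \<longrightarrow>
        x (int l * q - int i + int r) = \<theta> (col \<theta> k (nat (int e + q)) a) ! r)" for N
  proof -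
    define M where "M = l * N + i"
    obtain k a p where *: "(p + M) mod l = i" "p + 2 * M \<le> l ^ Suc k"
      "\<And>j. j < 2 * M \<Longrightarrow> x (- int M + int j) = col \<theta> (Suc k) (p + j) a"
      using i(2)[of M] unfolding P_def by blast
    define e where "e = (p + M) div l"
    have e: "p + M = l * e + i"
      unfolding e_def using *(1) by (metis mult_div_mod_eq)
    have e': "p + l * N = l * e"
      using e by (simp add: M_def)
    have "l * N \<le> l * e" using e' by linarith
    then have 1: "N \<le> e" using l_pos by simp
    have "l * (e + N) \<le> l * l ^ k"
      using *(2) e by (simp add: M_def algebra_simps)
    then have 2: "e + N \<le> l ^ k" using l_pos by simp
    have 3: "x (int l * q - int i + int r) = \<theta> (col \<theta> k (nat (int e + q)) a) ! r"
      if "- int N \<le> q" "q < int N" "r < l" for q r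
    proof -
      define s where "s = nat (int N + q)"
      have s: "q = int s - int N" "s < 2 * N" using that by (auto simp: s_def)
      have "l * Suc s \<le> l * (2 * N)" using s by (intro mult_le_mono) auto
      then have "l * s + r < 2 * M" using that by (simp add: M_def)
      then have "x (- int M + int (l * s + r)) = col \<theta> (Suc k) (p + (l * s + r)) a"
        by (rule *(3))
      then have "x (int l * q - int i + int r) = col \<theta> (Suc k) (p + (l * s + r)) a"
        by (simp add: M_def s algebra_simps)
      moreover have "p + (l * s + r) = l * (e + s - N) + r"
      proof -
        have "l * (e + s - N) + l * N = l * (e + s)" 
          using 1 by (metis add_mult_distrib2 le_add_diff_inverse2 trans_le_add1)
        then show ?thesis using e' by (simp add: algebra_simps)
      qed
      moreover have "nat (int e + q) = e + s - N"
        using 1 s by simp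
      moreover have "l * (e + s - N) + r < l ^ Suc k"
        using calculation(2) *(2) \<open>l * s + r < 2 * M\<close> by linarith
      ultimately show ?thesis
        using col_Suc[of "l * (e + s - N) + r" k a] that by simp
    qed
    show ?thesis using 1 2 3 by blast
  qed
  have inj0: "inj (\<lambda>a. \<theta> a ! 0)"
    using bij_letter[of 0] l_pos bij_is_inj by simp
  have blocks: "x (int l * q - int i + int r) = \<theta> (y q) ! r" if r: "r < l" for q r
  proof -
    obtain k a e where "\<And>r. r < l \<Longrightarrow> x (int l * q - int i + int r) = \<theta> (col \<theta> k (nat (int e + q)) a) ! r"
      using y[of "nat \<bar>q\<bar> + 1"] by fastforce
    from this[of 0] this[of r] show ?thesis
      using l_pos r inv_into_f_f[OF inj0, of "col \<theta> k (nat (int e + q)) a"] by (simp add: y_def)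
  qed
  have "admits y (- int N) (2 * N)" for N
  proof -
    obtain k a e where *: "N \<le> e" "e + N \<le> l ^ k"
      "\<And>q r. - int N \<le> q \<Longrightarrow> q < int N \<Longrightarrow> r < l \<Longrightarrow>
        x (int l * q - int i + int r) = \<theta> (col \<theta> k (nat (int e + q)) a) ! r"
      using y[of N] by blast
    have "y (- int N + int j) = col \<theta> k (e - N + j) a" if "j < 2 * N" for j
    proof -
      have "nat (int e + (- int N + int j)) = e - N + j" using *(1) by simp
      then show ?thesis
        using *(3)[of "- int N + int j" 0] that l_pos
          inv_into_f_f[OF inj0, of "col \<theta> k (e - N + j) a"] by (simp add: y_def)
    qed
    then show ?thesis
      unfolding admits_def using *(1,2)
      by (intro exI[of _ k] exI[of _ a] exI[of _ "e - N"]) auto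
  qed
  then have "y \<in> X" by (simp add: subshift_iff_symmetric)
  moreover have "x = shift (int i) (S y)"
  proof
    fix t
    obtain q r where *: "r < l" "t + int i = int l * q + int r"
      using subst_seq_decompose .
    then have t: "t = int l * q - int i + int r" by simp
    have "x t = \<theta> (y q) ! r"
      using blocks[OF *(1)] by (simp add: t)
    then show "x t = shift (int i) (S y) t"
      using subst_seq_at[OF *(1)] *(2) by (simp add: shift_def)
  qed
  ultimately show ?thesis using i by blast
qed

lemma desubstitute_pow:
  assumes "x \<in> X"
  shows "\<exists>i<l ^ n. x \<in> shift (int i) ` (S ^^ n) ` X"
  using assms
proof (induction n arbitrary: x)
  case 0
  then show ?case by (auto simp: shift_def image_iff)
next
  case (Suc n)
  obtain i y where i: "i < l ^ n" "y \<in> X" "x = shift (int i) ((S ^^ n) y)"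
    using Suc by fastforce
  obtain j z where j: "j < l" "z \<in> X" "y = shift (int j) (S z)"
    using desubstitute[OF i(2)] by blast
  have "x = shift (int (l ^ n * j + i)) ((S ^^ Suc n) z)"
    by (simp add: i j subst_seq_pow_shift shift_shift add.commute funpow_swap1)
  moreover have "l ^ n * j + i < l ^ Suc n"
    using col_index_less[of j 1 i n] i j by simp
  ultimately show ?case using j by blast
qed

end

section \<open>Recognizability and the equicontinuous factor\<close>

text \<open>There are finitely many self-maps of a finite set, so two powers of \<open>f\<close>
  coincide, and injectivity cancels the smaller one.\<close>

lemma bij_funpow_eq_id:
  fixes f :: "'a::finite \<Rightarrow> 'a"
  assumes "bij f"
  obtains p where "0 < p" "f ^^ p = id"
proof -
  have "\<not> inj (\<lambda>n. f ^^ n)"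
    using finite_imageD[of "\<lambda>n. f ^^ n" UNIV] by auto
  then obtain i j where ij: "i < j" "f ^^ i = f ^^ j"
    unfolding inj_def by (metis linorder_neqE_nat)
  have "f ^^ (j - i) = id"
  proof
    fix a
    have "(f ^^ i) ((f ^^ (j - i)) a) = (f ^^ i) a"
      using ij fun_cong[OF funpow_add[of i "j - i" f], of a] by simp
    moreover have "inj (f ^^ i)"
      using assms by (simp add: bij_is_inj)
    ultimately show "(f ^^ (j - i)) a = id a"
      by (simp add: inj_eq)
  qed
  with ij that[of "j - i"] show thesis by simp
qed

text \<open>Any \<open>p\<close> with \<open>f ^^ p = id\<close> is a period of \<open>x\<close>.
  Every appeal to aperiodicity goes through this.\<close>

lemma recurrence_imp_periodic:
  fixes x :: "int \<Rightarrow> 'a::finite"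
  assumes "bij f" "\<And>k. x (k + 1) = f (x k)"
  shows "\<exists>p>0. shift p x = x"
proof -
  obtain p where p: "0 < p" "f ^^ p = id"
    using bij_funpow_eq_id[OF assms(1)] .
  have "x (k + int n) = (f ^^ n) (x k)" for k n
  proof (induction n)
    case (Suc n)
    then show ?case using assms(2)[of "k + int n"] by (simp add: algebra_simps)
  qed simp
  then have "shift (int p) x = x"
    using p by (auto simp: shift_def)
  then show ?thesis using p by (intro exI[of _ "int p"]) simp
qed

locale aperiodic_bijective_substitution = bijective_substitution +
  assumes aperiodic: "x \<in> X \<Longrightarrow> 0 < p \<Longrightarrow> shift p x \<noteq> x"
begin

text \<open>If two cuttings of the same point disagreed, comparing letters at both sets of cutting points
  would express each letter of a preimage as a fixed permutation of the preceding one.\<close>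

lemma cutting_aux:
  assumes "y' \<in> X" "d < l ^ n" "(S ^^ n) y = shift (int d) ((S ^^ n) y')"
  shows "d = 0"
proof (rule ccontr)
  assume "d \<noteq> 0"
  define c where "c = col \<theta> n"
  define L where "L = l ^ n"
  have bij_c: "bij (c j)" if "j < L" for j
    using that bij_col by (simp add: c_def L_def)
  have at: "(S ^^ n) u (int L * q + int j) = c j (u q)" if "j < L" for u q j
    using that subst_seq_pow_at unfolding c_def L_def by blast
  have dL: "d < L" "L - d < L" "0 < L"
    using assms \<open>d \<noteq> 0\<close> l_pos by (auto simp: L_def)
  \<comment> \<open>Position \<open>L q\<close> starts block \<open>q\<close> of \<open>y\<close>
    and has offset \<open>d\<close> in block \<open>q\<close> of \<open>y'\<close>; position
    \<open>L q + L - d\<close> starts block \<open>q + 1\<close> of \<open>y'\<close>.\<close>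
  have 1: "c 0 (y q) = c d (y' q)" for q
  proof -
    have "c 0 (y q) = (S ^^ n) y (int L * q)"
      using at[of 0 y q] dL by simp
    also have "\<dots> = c d (y' q)"
      using at[of d y' q] dL assms(3) by (simp add: shift_def)
    finally show ?thesis .
  qed
  have 2: "c (L - d) (y q) = c 0 (y' (q + 1))" for q
  proof -
    have "c (L - d) (y q) = (S ^^ n) y (int L * q + int (L - d))"
      using at[of "L - d" y q] dL by simp
    also have "\<dots> = (S ^^ n) y' (int L * (q + 1) + int 0)"
      using dL assms(3) by (simp add: shift_def algebra_simps)
    also have "\<dots> = c 0 (y' (q + 1))"
      by (rule at[OF dL(3)])
    finally show ?thesis .
  qed
  define \<tau> where "\<tau> = inv_into UNIV (c 0) \<circ> c d"
  define \<rho> where "\<rho> = inv_into UNIV (c 0) \<circ> c (L - d)"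
  have inv0: "inv_into UNIV (c 0) (c 0 a) = a" for a
    using bij_c[OF dL(3)] by (simp add: bij_is_inj)
  \<comment> \<open>Going from \<open>y' q\<close> to \<open>y q\<close> and on to
    \<open>y' (q + 1)\<close> yields the recurrence.\<close>
  have "y q = \<tau> (y' q)" "y' (q + 1) = \<rho> (y q)" for q
    using 1[of q] 2[of q] inv0 by (metis \<tau>_def comp_apply, metis \<rho>_def comp_apply)
  then have "y' (q + 1) = (\<rho> \<circ> \<tau>) (y' q)" for q by simp
  moreover have "bij (\<rho> \<circ> \<tau>)"
    using bij_c dL by (simp add: \<rho>_def \<tau>_def bij_imp_bij_inv bij_comp)
  ultimately show False
    using recurrence_imp_periodic[of "\<rho> \<circ> \<tau>" y'] aperiodic assms(1) by blast
qed

lemma cutting_unique: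
  assumes "y \<in> X" "y' \<in> X" "i < l ^ n" "j < l ^ n"
    and "shift (int i) ((S ^^ n) y) = shift (int j) ((S ^^ n) y')"
  shows "i = j"
proof -
  have le: "a = b" if "u \<in> X" "b < l ^ n" "a \<le> b"
    "shift (int a) ((S ^^ n) v) = shift (int b) ((S ^^ n) u)" for a b u v
  proof -
    have "(S ^^ n) v = shift (- int a) (shift (int b) ((S ^^ n) u))"
      by (simp flip: that(4) add: shift_shift) (simp add: shift_def)
    then have "(S ^^ n) v = shift (int (b - a)) ((S ^^ n) u)"
      using that(3) by (simp add: shift_shift)
    then have "b - a = 0"
      using cutting_aux[of u "b - a" n v] that by linarith
    then show ?thesis using that by simp
  qed
  show ?thesis
    using le[of y' j i y] le[of y i j y'] assms by (cases "i \<le> j") (auto dest: sym)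
qed

text \<open>Existence from \<open>desubstitute_pow\<close> and uniqueness from
  \<open>cutting_unique\<close> justify the description operator in
  \<open>factor_level\<close>.\<close>

lemma factor_level_iff:
  assumes "x \<in> X"
  shows "factor_level \<theta> l n x = i \<longleftrightarrow> i < l ^ n \<and> x \<in> shift (int i) ` (S ^^ n) ` X"
proof -
  have "\<exists>!i. i < l ^ n \<and> x \<in> shift (int i) ` (S ^^ n) ` X"
    using desubstitute_pow[OF assms, of n] cutting_unique by blast
  from theI'[OF this] this show ?thesis
    unfolding factor_level_def by blast
qed

lemma fibre_iff:
  "x \<in> fibre \<theta> l z \<longleftrightarrow>
     x \<in> X \<and> (\<forall>n. z n < l ^ n \<and> x \<in> shift (int (z n)) ` (S ^^ n) ` X)"
proof (cases "x \<in> X")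
  case True
  have "(\<lambda>n. factor_level \<theta> l n x) = z \<longleftrightarrow> (\<forall>n. factor_level \<theta> l n x = z n)"
    by auto
  with True show ?thesis
    by (simp add: fibre_def factor_map_def factor_level_iff)
qed (simp add: fibre_def)

lemma zero_fibre_iff: "x \<in> zero_fibre \<theta> l \<longleftrightarrow> (\<forall>n. x \<in> (S ^^ n) ` X)"
proof -
  have "shift 0 ` A = A" for A :: "(int \<Rightarrow> 'a) set"
    by (simp add: shift_def)
  moreover have "x \<in> X" if "\<forall>n. x \<in> (S ^^ n) ` X"
    using spec[OF that, of 0] by simp
  ultimately show ?thesis
    by (auto simp: fibre_iff l_pos)
qed

text \<open>This is closedness of the pieces of the level \<open>n\<close> partition. The
  approximating preimages \<open>w\<close> need no convergent choice: on each window bijectivity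
  forces them to agree with the \<open>y\<close> computed from \<open>x\<close>.\<close>

lemma cylinder_closed:
  assumes "\<And>N. \<exists>w\<in>X. \<forall>t. - int N \<le> t \<longrightarrow> t < int N \<longrightarrow> x t = shift (int i) ((S ^^ n) w) t"
    and "i < l ^ n"
  shows "x \<in> shift (int i) ` (S ^^ n) ` X"
proof -
  define L where "L = l ^ n"
  have iL: "i < L" "0 < L" using assms(2) l_pos by (auto simp: L_def)
  define c where "c = col \<theta> n"
  have at: "(S ^^ n) u (int L * q + int j) = c j (u q)" if "j < L" for u q j
    using that subst_seq_pow_at unfolding c_def L_def by blast
  define y where "y q = inv_into UNIV (c 0) (x (int L * q - int i))" for q
  have inv0: "inv_into UNIV (c 0) (c 0 a) = a" for a
    using bij_col[of 0 n] iL(2) by (simp add: bij_is_inj c_def L_def)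
  have approx: "\<exists>w\<in>X. (\<forall>q. - int N \<le> q \<longrightarrow> q < int N \<longrightarrow>
      w q = y q \<and> (\<forall>r<L. x (int L * q - int i + int r) = c r (w q)))" for N
  proof -
    \<comment> \<open>The factor \<open>N + 1\<close> instead of \<open>N\<close> leaves room for
      the offset \<open>i < L\<close>.\<close>
    obtain w where w: "w \<in> X" "\<And>t. - int (L * (N + 1)) \<le> t \<Longrightarrow> t < int (L * (N + 1)) \<Longrightarrow>
        x t = shift (int i) ((S ^^ n) w) t"
      using assms(1) by blast
    have eq: "x (int L * q - int i + int r) = c r (w q)"
      if "- int N \<le> q" "q < int N" "r < L" for q r
    proof -
      have "int L * (- int N) \<le> int L * q" "int L * q \<le> int L * int N"
        using that by (intro mult_left_mono; simp)+
      moreover have "int (L * (N + 1)) = int L * int N + int L" "int L * (- int N) = - (int L * int N)"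
        by (simp_all add: algebra_simps)
      ultimately have "x (int L * q - int i + int r) = shift (int i) ((S ^^ n) w) (int L * q - int i + int r)"
        using iL that by (intro w(2)) linarith+
      also have "\<dots> = c r (w q)"
        using at[OF that(3)] by (simp add: shift_def)
      finally show ?thesis .
    qed
    have "w q = y q" if "- int N \<le> q" "q < int N" for q
      using eq[OF that iL(2)] inv0 by (simp add: y_def)
    with w eq show ?thesis by blast
  qed
  have "admits y (- int N) (2 * N)" for N
  proof -
    obtain w where w: "w \<in> X" "\<And>q. - int N \<le> q \<Longrightarrow> q < int N \<Longrightarrow> w q = y q"
      using approx[of N] by blast
    have "admits w (- int N) (2 * N)"
      using w by (simp add: subshift_iff)
    then show ?thesis
      using admits_cong[of "- int N" "2 * N" w y] w(2) by simp
  qed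
  then have "y \<in> X" by (simp add: subshift_iff_symmetric)
  moreover have "x = shift (int i) ((S ^^ n) y)"
  proof
    fix t
    obtain q r where *: "r < L" "t + int i = int L * q + int r"
      using int_decompose[of n "t + int i"] unfolding L_def .
    then have t: "t = int L * q - int i + int r" by simp
    have "x t = c r (y q)"
      using approx[of "nat \<bar>q\<bar> + 1"] *(1) unfolding t by fastforce
    then show "x t = shift (int i) ((S ^^ n) y) t"
      using at[OF *(1)] *(2) by (simp add: shift_def)
  qed
  ultimately show ?thesis by blast
qed

end

section \<open>Pointwise limits of shifts\<close>

text \<open>By Tychonoff the space of all functions is compact, so the closures of the tails of
  \<open>g\<close> have a common point. The index type may be uncountable, hence a cluster point
  rather than a convergent subsequence.\<close>

lemma finite_valued_cluster_point:
  fixes g :: "nat \<Rightarrow> 'i \<Rightarrow> 'a::finite"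
  obtains f where "\<And>N F. finite F \<Longrightarrow> \<exists>n\<ge>N. \<forall>i\<in>F. f i = g n i"
proof -
  define T :: "('i \<Rightarrow> 'a) topology" where "T = product_topology (\<lambda>_. discrete_topology UNIV) UNIV"
  have top: "topspace T = UNIV"
    by (simp add: T_def)
  have "compact_space T"
    by (simp add: T_def compact_space_product_topology compact_space_discrete_topology)
  moreover have "T closure_of (g ` {N..}) \<noteq> {}" for N
    by (simp add: closure_of_eq_empty top)
  moreover have "decseq (\<lambda>N. T closure_of (g ` {N..}))"
    by (auto intro!: decseq_SucI closure_of_mono)
  ultimately have "(\<Inter>N. T closure_of (g ` {N..})) \<noteq> {}"
    by (intro compact_space_imp_nest) auto
  then obtain f where f: "f \<in> T closure_of (g ` {N..})" for N
    by blast
  have "\<exists>n\<ge>N. \<forall>i\<in>F. f i = g n i" if "finite F" for N F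
  proof -
    let ?U = "PiE UNIV (\<lambda>i. if i \<in> F then {f i} else UNIV)"
    have "openin T ?U"
      unfolding T_def openin_PiE_gen using that
      by (intro disjI2 conjI) (auto elim: rev_finite_subset)
    moreover have "f \<in> ?U" by auto
    ultimately obtain n where n: "n \<ge> N" "g n \<in> ?U"
      using f[of N] unfolding in_closure_of by blast
    have "f i = g n i" if "i \<in> F" for i
      using PiE_mem[OF n(2), of i] that by simp
    with n(1) show ?thesis by blast
  qed
  then show thesis by (rule that)
qed

section \<open>Cylinder sets and a combinatorial description of the Ellis semigroup\<close>

lemma topspace_subshift_topology: "topspace (subshift_topology \<theta>) = subshift \<theta>"
  by (simp add: subshift_topology_def)

lemma openin_subshift_cylinder:
  assumes "finite W"
  shows "openin (subshift_topology \<theta>) {y \<in> subshift \<theta>. \<forall>k\<in>W. y k = x k}"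
proof -
  let ?U = "PiE UNIV (\<lambda>k. if k \<in> W then {x k} else UNIV)"
  have "openin (product_topology (\<lambda>_. discrete_topology UNIV) UNIV) ?U"
    unfolding openin_PiE_gen using assms
    by (intro disjI2 conjI) (auto elim: rev_finite_subset)
  moreover have "{y \<in> subshift \<theta>. \<forall>k\<in>W. y k = x k} = ?U \<inter> subshift \<theta>"
    by (auto simp: PiE_iff split: if_splits)
  ultimately show ?thesis
    unfolding subshift_topology_def openin_subtopology by blast
qed

lemma openin_subshift_contains_cylinder:
  assumes "openin (subshift_topology \<theta>) U" "x \<in> U"
  obtains W where "finite W" "{y \<in> subshift \<theta>. \<forall>k\<in>W. y k = x k} \<subseteq> U"
proof -
  obtain V where V: "openin (product_topology (\<lambda>_. discrete_topology UNIV) UNIV) V" "U = V \<inter> subshift \<theta>"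
    using assms(1) unfolding subshift_topology_def openin_subtopology by blast
  then obtain B where B: "x \<in> PiE UNIV B" "finite {k. B k \<noteq> UNIV}" "PiE UNIV B \<subseteq> V"
    using product_topology_open_contains_basis[OF V(1), of x] assms(2) by auto
  have "{y \<in> subshift \<theta>. \<forall>k\<in>{k. B k \<noteq> UNIV}. y k = x k} \<subseteq> U"
  proof
    fix y assume y: "y \<in> {y \<in> subshift \<theta>. \<forall>k\<in>{k. B k \<noteq> UNIV}. y k = x k}"
    have "y k \<in> B k" for k
      using y B(1) by (cases "B k = UNIV") (auto simp: PiE_iff)
    then show "y \<in> U" using y B V by auto
  qed
  with B(2) show thesis by (rule that)
qed

text \<open>A basic neighbourhood of \<open>f\<close> constrains the values at finitely many points,
  each in finitely many positions. Later arguments use the Ellis semigroup only in this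
  form.\<close>

lemma (in bijective_substitution) ellis_iff:
  "f \<in> ellis \<theta> \<longleftrightarrow> f \<in> subshift \<theta> \<rightarrow>\<^sub>E subshift \<theta> \<and>
    (\<forall>F W. finite F \<longrightarrow> F \<subseteq> subshift \<theta> \<longrightarrow> finite W \<longrightarrow>
      (\<exists>t. \<forall>x\<in>F. \<forall>k\<in>W. f x k = x (k + t)))"
    (is "?L \<longleftrightarrow> ?fun \<and> ?R")
proof
  let ?X = "subshift \<theta>"
  let ?T = "product_topology (\<lambda>_. subshift_topology \<theta>) ?X"
  assume f: ?L
  then have ext: ?fun
    by (simp add: ellis_def in_closure_of topspace_subshift_topology)
  have "\<exists>t. \<forall>x\<in>F. \<forall>k\<in>W. f x k = x (k + t)" if "finite F" "F \<subseteq> ?X" "finite W" for F W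
  proof -
    let ?B = "\<lambda>x. if x \<in> F then {y \<in> ?X. \<forall>k\<in>W. y k = f x k} else ?X"
    have "{i \<in> ?X. ?B i \<noteq> topspace (subshift_topology \<theta>)} \<subseteq> F"
      by (auto simp: topspace_subshift_topology)
    then have "finite {i \<in> ?X. ?B i \<noteq> topspace (subshift_topology \<theta>)}"
      using that(1) finite_subset by blast
    then have "openin ?T (PiE ?X ?B)"
      using openin_subshift_cylinder[OF that(3), where \<theta> = \<theta>]
        openin_topspace[of "subshift_topology \<theta>"]
      unfolding openin_PiE_gen by (simp add: topspace_subshift_topology)
    moreover have "f \<in> PiE ?X ?B"
      using ext by (auto simp: PiE_iff)
    ultimately obtain g where g: "g \<in> range (\<lambda>t. restrict (shift t) ?X)" "g \<in> PiE ?X ?B"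
      using f unfolding ellis_def in_closure_of by blast
    then obtain t where t: "g = restrict (shift t) ?X"
      by blast
    have "f x k = x (k + t)" if "x \<in> F" "k \<in> W" for x k
      using PiE_mem[OF g(2), of x] that \<open>F \<subseteq> ?X\<close> by (auto simp: t shift_def)
    then show ?thesis by blast
  qed
  with ext show "?fun \<and> ?R" by blast
next
  let ?X = "subshift \<theta>"
  let ?T = "product_topology (\<lambda>_. subshift_topology \<theta>) ?X"
  assume f: "?fun \<and> ?R"
  have "\<exists>g. g \<in> range (\<lambda>t. restrict (shift t) ?X) \<and> g \<in> V" if V: "f \<in> V" "openin ?T V" for V
  proof -
    obtain U where U: "finite {x \<in> ?X. U x \<noteq> topspace (subshift_topology \<theta>)}"
      "\<And>x. x \<in> ?X \<Longrightarrow> openin (subshift_topology \<theta>) (U x)" "f \<in> PiE ?X U" "PiE ?X U \<subseteq> V"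
      using V(2)[unfolded openin_product_topology_alt, rule_format, OF V(1)] by blast
    \<comment> \<open>These are the points that the basic neighbourhood really constrains; one shift
      has to match \<open>f\<close> on the union of their windows.\<close>
    define F where "F = {x \<in> ?X. U x \<noteq> ?X}"
    have F: "finite F" "F \<subseteq> ?X"
      using U(1) by (auto simp: F_def topspace_subshift_topology)
    have "\<exists>W. finite W \<and> {y \<in> ?X. \<forall>k\<in>W. y k = f x k} \<subseteq> U x" if "x \<in> ?X" for x
      by (rule openin_subshift_contains_cylinder[OF U(2)[OF that] PiE_mem[OF U(3) that]]) blast
    then have "\<forall>x\<in>?X. \<exists>W. finite W \<and> {y \<in> ?X. \<forall>k\<in>W. y k = f x k} \<subseteq> U x"
      by blast
    from bchoice[OF this] obtain W where W: "\<And>x. x \<in> ?X \<Longrightarrow> finite (W x)"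
      "\<And>x. x \<in> ?X \<Longrightarrow> {y \<in> ?X. \<forall>k\<in>W x. y k = f x k} \<subseteq> U x"
      by blast
    have "finite (\<Union>x\<in>F. W x)"
      using F W(1) by blast
    with conjunct2[OF f, rule_format, OF F]
    obtain t where t: "\<forall>x\<in>F. \<forall>k\<in>(\<Union>x\<in>F. W x). f x k = x (k + t)"
      by presburger
    have "shift t x \<in> U x" if x: "x \<in> ?X" for x
    proof (cases "x \<in> F")
      case True
      have "shift t x \<in> {y \<in> ?X. \<forall>k\<in>W x. y k = f x k}"
        using t True shift_in_subshift[OF x] by (auto simp: shift_def)
      then show ?thesis using W(2)[OF x] by blast
    next
      case False
      then show ?thesis using x shift_in_subshift by (simp add: F_def)
    qed
    then have "restrict (shift t) ?X \<in> PiE ?X U" by auto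
    with U(4) show ?thesis by blast
  qed
  then show ?L
    using f by (auto simp: ellis_def in_closure_of topspace_subshift_topology)
qed

section \<open>The zero fibre\<close>

context bijective_substitution
begin

text \<open>The allowed two-letter words as adjacent columns evaluated at one letter; the quotients
  of such columns form the R-set.\<close>

definition allowed_pair :: "'a \<Rightarrow> 'a \<Rightarrow> bool" where
  "allowed_pair a b \<longleftrightarrow> (\<exists>k p c. Suc p < l ^ k \<and> a = col \<theta> k p c \<and> b = col \<theta> k (Suc p) c)"

lemma admits_2_iff: "admits x i 2 \<longleftrightarrow> allowed_pair (x i) (x (i + 1))"
proof -
  have "(\<forall>j<2. P j) \<longleftrightarrow> P 0 \<and> P (Suc 0)" for P :: "nat \<Rightarrow> bool"
    by (auto simp: less_2_cases_iff)
  then show ?thesis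
    unfolding admits_def allowed_pair_def by (auto simp: Suc_le_eq)
qed

lemma allowed_pair_in_subshift: "x \<in> X \<Longrightarrow> allowed_pair (x k) (x (k + 1))"
  by (simp add: subshift_iff flip: admits_2_iff)

lemma admits_subst_seq_pow:
  "admits x i m \<Longrightarrow> admits ((S ^^ n) x) (int (l ^ n) * i) (l ^ n * m)"
proof (induction n)
  case (Suc n)
  then show ?case
    using admits_subst_seq[of "(S ^^ n) x" "int (l ^ n) * i" "l ^ n * m"] by (simp add: mult.assoc)
qed simp

lemma less_length_pow: "n < l ^ n"
  using l_ge_2 by (meson less_exp order.strict_trans2 power_mono zero_le)

text \<open>Iterating \<open>S ^^ p\<close> from a seed with centre \<open>ab\<close> keeps the
  centre, so the window of radius \<open>L ^ n\<close> is constant from iterate \<open>n\<close> on,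
  and the limit is fixed. Its windows are allowed because they are images of the allowed word
  \<open>ab\<close>.\<close>

lemma fixed_point_exists:
  assumes pair: "allowed_pair a b" and p: "0 < p"
    and ab: "col \<theta> p (l ^ p - 1) a = a" "col \<theta> p 0 b = b"
  obtains x where "x \<in> X" "(S ^^ p) x = x" "x (- 1) = a" "x 0 = b"
proof -
  define T where "T = S ^^ p"
  define L where "L = l ^ p"
  define c where "c = col \<theta> p"
  have L: "2 \<le> L" "0 < L"
    using p l_ge_2 self_le_power[of l p] by (auto simp: L_def)
  have at: "T u (int L * q + int j) = c j (u q)" if "j < L" for u q j
    using that subst_seq_pow_at unfolding c_def L_def T_def by blast
  \<comment> \<open>Only the two central letters of the seed matter; the seed itself may lie outside
    \<open>X\<close>.\<close>
  define U where "U n = (T ^^ n) (\<lambda>k. if k < 0 then a else b)" for n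
  have U_Suc: "U (Suc n) = T (U n)" for n
    by (simp add: U_def)
  have centre: "U n (- 1) = a \<and> U n 0 = b" for n
  proof (induction n)
    case (Suc n)
    have "- 1 = int L * (- 1) + int (L - 1)" "0 = int L * 0 + int 0"
      using L by (auto simp: of_nat_diff)
    then have "T (U n) (- 1) = c (L - 1) (U n (- 1))" "T (U n) 0 = c 0 (U n 0)"
      using at[of "L - 1" "U n" "- 1"] at[of 0 "U n" 0] L by simp_all
    then show ?case
      using Suc ab by (simp add: U_Suc c_def L_def)
  qed (simp add: U_def)
  \<comment> \<open>The window of radius \<open>L ^ Suc n\<close> consists of the images of the
    letters in the window of radius \<open>L ^ n\<close>.\<close>
  have block: "- int (L ^ n) \<le> q \<and> q < int (L ^ n)"
    if "- int (L ^ Suc n) \<le> int L * q + int j" "int L * q + int j < int (L ^ Suc n)" "j < L" for n q j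
  proof -
    have "int L * (- int (L ^ n)) = - int (L ^ Suc n)" "int L * int (L ^ n) = int (L ^ Suc n)"
      "int L * (q + 1) = int L * q + int L"
      by (simp_all add: algebra_simps)
    then have "int L * (- int (L ^ n)) < int L * (q + 1)" "int L * q < int L * int (L ^ n)"
      using that by linarith+
    then have "- int (L ^ n) < q + 1" "q < int (L ^ n)"
      using L(2) by (simp_all only: mult_less_cancel_left_pos of_nat_0_less_iff)
    then show ?thesis by simp
  qed
  have U_step: "U (Suc n) k = U n k" if "- int (L ^ n) \<le> k" "k < int (L ^ n)" for n k
    using that
  proof (induction n arbitrary: k)
    case 0
    then have "k = - 1 \<or> k = 0" by auto
    then show ?case using centre by auto
  next
    case (Suc n)
    obtain q j where *: "j < L" "k = int L * q + int j"
      using int_decompose[of p k] unfolding L_def .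
    have "U (Suc n) q = U n q"
      using Suc.prems block[of n q j] * by (intro Suc.IH) auto
    then show ?case
      using at[OF *(1)] by (simp add: U_Suc *(2))
  qed
  have stable: "U m k = U n k" if "n \<le> m" "- int (L ^ n) \<le> k" "k < int (L ^ n)" for m n k
    using that(1)
  proof (induction m rule: dec_induct)
    case (step m)
    have "L ^ n \<le> L ^ m" using step(1) L by (simp add: power_increasing)
    then have "int (L ^ n) \<le> int (L ^ m)" by (rule of_nat_mono)
    then show ?case using U_step[of m k] that step by simp
  qed simp
  have lt: "n < L ^ n" for n
    using L(1) by (meson less_exp order.strict_trans2 power_mono zero_le)
  \<comment> \<open>The iterate \<open>nat \<bar>k\<bar> + 1\<close> is already stable at
    \<open>k\<close>, because \<open>n < L ^ n\<close>.\<close>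
  define x where "x k = U (nat \<bar>k\<bar> + 1) k" for k
  have x_eq: "x k = U n k" if "- int (L ^ n) \<le> k" "k < int (L ^ n)" for k n
  proof -
    have *: "- int (L ^ (nat \<bar>k\<bar> + 1)) \<le> k" "k < int (L ^ (nat \<bar>k\<bar> + 1))"
      using lt[of "nat \<bar>k\<bar> + 1"] by linarith+
    show ?thesis
      unfolding x_def using stable[of "nat \<bar>k\<bar> + 1" n k] stable[of n "nat \<bar>k\<bar> + 1" k] * that
      by (cases "n \<le> nat \<bar>k\<bar> + 1") auto
  qed
  have "T x = x"
  proof
    fix k
    obtain q j where *: "j < L" "k = int L * q + int j"
      using int_decompose[of p k] unfolding L_def .
    define n where "n = nat \<bar>k\<bar> + nat \<bar>q\<bar> + 1"
    have "int (nat \<bar>k\<bar> + nat \<bar>q\<bar> + 1) < int (L ^ n)"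
      using lt[of n] unfolding n_def by (simp only: of_nat_less_iff)
    then have "- int (L ^ n) \<le> k" "k < int (L ^ n)" "- int (L ^ n) \<le> q" "q < int (L ^ n)"
      by linarith+
    then have "x q = U n q" "x k = U n k" "U (Suc n) k = U n k"
      using x_eq U_step by simp_all
    moreover have "T x k = c j (x q)" "U (Suc n) k = c j (U n q)"
      using at[OF *(1)] by (simp_all add: *(2) U_Suc)
    ultimately show "T x k = x k" by simp
  qed
  \<comment> \<open>The window of \<open>U n\<close> of radius \<open>L ^ n\<close> is the image of
    the central pair of the seed, and \<open>x\<close> agrees with \<open>U n\<close> there.\<close>
  have "admits (U 0) (- 1) 2"
    using pair centre[of 0] by (simp add: admits_2_iff)
  then have "admits (U n) (int (L ^ n) * - 1) (L ^ n * 2)" for n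
  proof (induction n)
    case (Suc n)
    then show ?case
      using admits_subst_seq_pow[of "U n" "int (L ^ n) * - 1" "L ^ n * 2" p]
      by (simp add: U_Suc T_def L_def mult.assoc)
  qed simp
  moreover have "admits (U n) (int (L ^ n) * - 1) (L ^ n * 2) = admits x (int (L ^ n) * - 1) (L ^ n * 2)" for n
    by (intro admits_cong) (simp add: x_eq)
  ultimately have ad: "admits x (int (L ^ n) * - 1) (L ^ n * 2)" for n
    by blast
  have "admits x (- int N) (2 * N)" for N
    by (rule admits_mono[OF ad[of N]]) (use less_imp_le[OF lt[of N]] in simp_all)
  then have "x \<in> X" by (simp add: subshift_iff_symmetric)
  moreover have "x (- 1) = a" "x 0 = b"
    using centre by (auto simp: x_def)
  ultimately show thesis
    using \<open>T x = x\<close> that by (simp add: T_def)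
qed

lemma col_first: "col \<theta> n 0 = col \<theta> 1 0 ^^ n"
proof (induction n)
  case (Suc n)
  then show ?case using col_add[of 0 n 0 1] l_pos by simp
qed (auto simp: col_0)

lemma col_last: "col \<theta> n (l ^ n - 1) = col \<theta> 1 (l - 1) ^^ n"
proof (induction n)
  case (Suc n)
  have "l ^ 1 * (l ^ n - 1) + (l - 1) = l ^ Suc n - 1"
    using l_pos(1) l_pos(2)[of n] by (simp add: diff_mult_distrib2)
  then show ?case using Suc col_add[of "l ^ n - 1" n "l - 1" 1] l_pos by simp
qed (auto simp: col_0)

end

section \<open>Consequences of being simplified: the edge columns are trivial\<close>

locale simplified_bijective_substitution = aperiodic_bijective_substitution +
  assumes fixed: "x \<in> X \<Longrightarrow> 0 < p \<Longrightarrow> (S ^^ p) x = x \<Longrightarrow> S x = x"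
    and letters: "b \<in> set (\<theta> a)"
begin

text \<open>The image of letter 1 of \<open>\<theta> b\<close> contains \<open>b\<close>; inside the
  second iterate of \<open>b\<close> this occurrence is at a position at least \<open>l\<close>, so
  it has a left neighbour.\<close>

lemma letter_is_second: "\<exists>a. allowed_pair a b"
proof -
  obtain j where j: "j < l" "\<theta> (col \<theta> 1 1 b) ! j = b"
    using letters[of b "col \<theta> 1 1 b"] by (auto simp: in_set_conv_nth len)
  have "Suc (l + j - 1) < l ^ 2" "Suc (l + j - 1) = l * 1 + j"
    unfolding power2_eq_square using j l_ge_2 mult_le_mono2[OF l_ge_2, of l] by linarith+
  moreover have "col \<theta> 2 (l * 1 + j) b = b"
    using fun_cong[OF col_add[of 1 1 j 1], of b] col_Suc[of j 0] l_ge_2 j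
    by (simp add: col_0 numeral_2_eq_2)
  ultimately show ?thesis
    unfolding allowed_pair_def by metis
qed

text \<open>The image of letter 0 of \<open>\<theta> a\<close> contains \<open>a\<close>; inside the
  second iterate of \<open>a\<close> this occurrence is before position \<open>l\<close>, so it has
  a right neighbour.\<close>

lemma letter_is_first: "\<exists>b. allowed_pair a b"
proof -
  obtain j where j: "j < l" "\<theta> (col \<theta> 1 0 a) ! j = a"
    using letters[of a "col \<theta> 1 0 a"] by (auto simp: in_set_conv_nth len)
  have "Suc j < l ^ 2"
    unfolding power2_eq_square using j mult_le_mono2[OF l_ge_2, of l] by linarith
  moreover have "col \<theta> 2 j a = a"
    using fun_cong[OF col_add[of 0 1 j 1], of a] col_Suc[of j 0] l_ge_2 j
    by (simp add: col_0 numeral_2_eq_2)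
  ultimately show ?thesis
    unfolding allowed_pair_def by metis
qed

text \<open>Some power of the substitution has trivial edge columns, so every allowed pair is the
  centre of a periodic point. That point is fixed by \<open>S\<close>, and reading it at
  \<open>- 1\<close> and \<open>0\<close> shows that the edge columns fix both letters of the
  pair.\<close>

lemma col_edges: "col \<theta> 1 0 = id \<and> col \<theta> 1 (l - 1) = id"
proof -
  have "bij (col \<theta> 1 0)" "bij (col \<theta> 1 (l - 1))"
    using bij_col l_pos by simp_all
  then obtain p1 p2 where p: "0 < p1" "col \<theta> 1 0 ^^ p1 = id" "0 < p2" "col \<theta> 1 (l - 1) ^^ p2 = id"
    by (meson bij_funpow_eq_id)
  \<comment> \<open>The product is a common period of the two edge columns.\<close>
  have "col \<theta> 1 0 ^^ (p1 * p2) = (col \<theta> 1 0 ^^ p1) ^^ p2"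
    "col \<theta> 1 (l - 1) ^^ (p1 * p2) = (col \<theta> 1 (l - 1) ^^ p2) ^^ p1"
    by (simp_all add: funpow_mult mult.commute)
  then have id: "col \<theta> (p1 * p2) 0 = id" "col \<theta> (p1 * p2) (l ^ (p1 * p2) - 1) = id"
    using p col_first[of "p1 * p2"] col_last[of "p1 * p2"] by simp_all
  have "col \<theta> 1 (l - 1) a = a \<and> col \<theta> 1 0 b = b" if pair: "allowed_pair a b" for a b
  proof -
    obtain x where x: "x \<in> X" "(S ^^ (p1 * p2)) x = x" "x (- 1) = a" "x 0 = b"
      using fixed_point_exists[OF pair, of "p1 * p2"] p id by auto
    have "S x = x" using fixed[OF x(1) _ x(2)] p by simp
    moreover have "- 1 = int (l ^ 1) * (- 1) + int (l - 1)" "0 = int (l ^ 1) * 0 + int 0"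
      using l_pos by (auto simp: of_nat_diff)
    ultimately show ?thesis
      using subst_seq_pow_at[of "l - 1" 1 x "- 1"] subst_seq_pow_at[of 0 1 x 0] x l_pos
      by (simp add: of_nat_diff)
  qed
  then show ?thesis
    using letter_is_first letter_is_second by (metis eq_id_iff)
qed

lemma col_first_eq: "col \<theta> n 0 = id"
  using col_first[of n] col_edges by simp

lemma col_last_eq: "col \<theta> n (l ^ n - 1) = id"
  using col_last[of n] col_edges by simp

lemma subst_seq_pow_block_start: "(S ^^ n) u (int (l ^ n) * q) = u q"
  using subst_seq_pow_at[of 0 n u q] l_pos by (simp add: col_first_eq)

lemma subst_seq_pow_block_end: "(S ^^ n) u (int (l ^ n) * q - 1) = u (q - 1)"
proof -
  have *: "int (l ^ n) * q - 1 = int (l ^ n) * (q - 1) + int (l ^ n - 1)"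
  proof -
    have "int (l ^ n) = 1 + int (l ^ n - 1)"
      using l_pos(2)[of n] by (metis Suc_diff_1 of_nat_Suc)
    then show ?thesis
      unfolding right_diff_distrib by linarith
  qed
  have "(S ^^ n) u (int (l ^ n) * (q - 1) + int (l ^ n - 1)) = id (u (q - 1))"
    using subst_seq_pow_at[of "l ^ n - 1" n u "q - 1"] l_pos(2)[of n]
    unfolding col_last_eq by linarith
  then show ?thesis
    by (simp only: * id_apply)
qed

section \<open>Points of the zero fibre and their two central letters\<close>

abbreviation "Z \<equiv> zero_fibre \<theta> l"

lemma zero_fibre_subset: "Z \<subseteq> X"
  by (auto simp: fibre_def)

text \<open>For each \<open>n\<close> the point is \<open>(S ^^ n) y\<close>, and the trivial edge
  columns give \<open>y\<close> the same central letters. So the right half depends only on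
  \<open>x 0\<close> and, in \<open>zero_fibre_left\<close>, the left half only on
  \<open>x (- 1)\<close>.\<close>

lemma zero_fibre_right:
  assumes "x \<in> Z" "j < l ^ n"
  shows "x (int j) = col \<theta> n j (x 0)"
proof -
  obtain y where y: "x = (S ^^ n) y"
    using assms(1) by (auto simp: zero_fibre_iff)
  then show ?thesis
    using subst_seq_pow_at[OF assms(2), of y 0] subst_seq_pow_block_start[of n y 0] by simp
qed

lemma zero_fibre_left:
  assumes "x \<in> Z" "j < l ^ n"
  shows "x (int j - int (l ^ n)) = col \<theta> n j (x (- 1))"
proof -
  obtain y where y: "x = (S ^^ n) y"
    using assms(1) by (auto simp: zero_fibre_iff)
  then show ?thesis
    using subst_seq_pow_at[OF assms(2), of y "- 1"] subst_seq_pow_block_end[of n y 0] by simp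
qed

lemma zero_fibre_eqI:
  assumes "x \<in> Z" "y \<in> Z" "x (- 1) = y (- 1)" "x 0 = y 0"
  shows "x = y"
proof
  fix k :: int
  have lt: "nat \<bar>k\<bar> < l ^ nat \<bar>k\<bar>"
    by (rule less_length_pow)
  show "x k = y k"
  proof (cases "0 \<le> k")
    case True
    then show ?thesis
      using zero_fibre_right[OF assms(1) lt] zero_fibre_right[OF assms(2) lt] assms by simp
  next
    case False
    define j where "j = l ^ nat \<bar>k\<bar> - nat \<bar>k\<bar>"
    have "j < l ^ nat \<bar>k\<bar>" "k = int j - int (l ^ nat \<bar>k\<bar>)"
      using False lt l_pos by (auto simp: j_def of_nat_diff)
    then show ?thesis
      using zero_fibre_left assms by metis
  qed
qed

lemma fixed_in_zero_fibre:
  assumes "x \<in> X" "S x = x"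
  shows "x \<in> Z"
proof -
  have "(S ^^ n) x = x" for n
    by (induction n) (simp_all add: assms)
  then show ?thesis
    unfolding zero_fibre_iff using assms(1) by (metis image_eqI)
qed

text \<open>At most one point fits by \<open>zero_fibre_eqI\<close>, and one exists exactly when
  \<open>ab\<close> is an allowed pair.\<close>

definition point :: "'a \<Rightarrow> 'a \<Rightarrow> int \<Rightarrow> 'a" where
  "point a b = (THE x. x \<in> Z \<and> x (- 1) = a \<and> x 0 = b)"

lemma point_eq:
  assumes "x \<in> Z"
  shows "point (x (- 1)) (x 0) = x"
  unfolding point_def using assms zero_fibre_eqI by (intro the_equality) auto

lemma
  assumes "allowed_pair a b"
  shows point_in_zero_fibre: "point a b \<in> Z"
    and subst_seq_point: "S (point a b) = point a b"
    and point_left: "point a b (- 1) = a"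
    and point_right: "point a b 0 = b"
proof -
  obtain x where x: "x \<in> X" "(S ^^ 1) x = x" "x (- 1) = a" "x 0 = b"
    by (rule fixed_point_exists[OF assms, of 1])
      (use col_first_eq[of 1] col_last_eq[of 1] in auto)
  then have "x \<in> Z"
    using fixed_in_zero_fibre by simp
  with x point_eq[of x] have "point a b = x" by simp
  with x \<open>x \<in> Z\<close> show "point a b \<in> Z" "S (point a b) = point a b"
    "point a b (- 1) = a" "point a b 0 = b"
    by simp_all
qed

text \<open>The point with the same centre was constructed as a fixed point, and the centre
  determines the point.\<close>

lemma subst_seq_zero_fibre: "x \<in> Z \<Longrightarrow> S x = x"
  using subst_seq_point[of "x (- 1)" "x 0"] point_eq[of x]
    allowed_pair_in_subshift[of x "- 1"] zero_fibre_subset by auto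

text \<open>Finiteness allows \<open>ellis_iff\<close> to be applied to all of \<open>Z\<close> at
  once.\<close>

lemma finite_zero_fibre: "finite Z"
proof (rule finite_surj)
  show "finite (UNIV :: ('a \<times> 'a) set)" by simp
  show "Z \<subseteq> (\<lambda>(a, b). point a b) ` UNIV"
    using point_eq by (auto simp: image_iff) metis
qed

end

section \<open>The fibre preserving part of the Ellis semigroup\<close>

context simplified_bijective_substitution
begin

definition limit_shift :: "int \<Rightarrow> (int \<Rightarrow> 'a) \<Rightarrow> int \<Rightarrow> 'a" where
  "limit_shift s = restrict (\<lambda>x. point (x (s - 1)) (x s)) Z"

lemma
  assumes "x \<in> Z"
  shows limit_shift_in_zero_fibre: "limit_shift s x \<in> Z"
    and limit_shift_left: "limit_shift s x (- 1) = x (s - 1)"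
    and limit_shift_right: "limit_shift s x 0 = x s"
proof -
  have "allowed_pair (x (s - 1)) (x s)"
    using allowed_pair_in_subshift[of x "s - 1"] assms zero_fibre_subset by auto
  then show "limit_shift s x \<in> Z" "limit_shift s x (- 1) = x (s - 1)" "limit_shift s x 0 = x s"
    using assms by (simp_all add: limit_shift_def point_in_zero_fibre point_left point_right)
qed

lemma eq_limit_shiftI:
  assumes "f \<in> Z \<rightarrow>\<^sub>E Z" "\<And>x. x \<in> Z \<Longrightarrow> f x (- 1) = x (s - 1)" "\<And>x. x \<in> Z \<Longrightarrow> f x 0 = x s"
  shows "f = limit_shift s"
proof (rule extensionalityI[of _ Z])
  show "f \<in> extensional Z" using assms(1) by (simp add: PiE_iff)
  show "limit_shift s \<in> extensional Z" by (simp add: limit_shift_def)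
  show "f x = limit_shift s x" if "x \<in> Z" for x
    using that assms PiE_mem[OF assms(1) that]
    by (intro zero_fibre_eqI) (simp_all add: limit_shift_in_zero_fibre limit_shift_left limit_shift_right)
qed

lemma zero_in_l_adic: "(\<lambda>_. 0) \<in> l_adic l"
  by (simp add: l_adic_def l_pos)

text \<open>The shifts by \<open>s l\<^sup>n\<close> stabilise on the zero fibre, where they act like \<open>limit_shift s\<close>; a cluster point of
  them extends \<open>limit_shift s\<close> to a fibre preserving element of the Ellis semigroup.\<close>

lemma limit_shift_in_ellis_fib0: "limit_shift s \<in> ellis_fib0 \<theta> l"
proof -
  \<comment> \<open>The index set consists of pairs of a point and a position, so the cluster point
    is taken for all points simultaneously.\<close>
  obtain h :: "(int \<Rightarrow> 'a) \<times> int \<Rightarrow> 'a" where h: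
    "\<And>N F. finite F \<Longrightarrow> \<exists>n\<ge>N. \<forall>i\<in>F. h i = fst i (snd i + s * int (l ^ n))"
    by (rule finite_valued_cluster_point[of "\<lambda>n i. fst i (snd i + s * int (l ^ n))"]) blast
  have h': "\<exists>n\<ge>N. \<forall>x\<in>F. \<forall>k\<in>W. h (x, k) = x (k + s * int (l ^ n))" 
    if "finite F" "finite W" for N F W
    using h[of "F \<times> W" N] that by simp
  define f where "f = restrict (\<lambda>x k. h (x, k)) X"
  have f_in: "f x \<in> X" if "x \<in> X" for x
  proof -
    have "admits (f x) i n" for i n
    proof -
      obtain m where "\<forall>k\<in>{i..<i + int n}. h (x, k) = x (k + s * int (l ^ m))"
        using h'[of "{x}" "{i..<i + int n}" 0] by auto
      then have "admits (f x) i n = admits (shift (s * int (l ^ m)) x) i n"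
        using that by (intro admits_cong) (simp add: f_def shift_def)
      then show ?thesis
        using shift_in_subshift[OF that] by (simp add: subshift_iff)
    qed
    then show ?thesis by (simp add: subshift_iff)
  qed
  have "\<exists>t. \<forall>x\<in>F. \<forall>k\<in>W. f x k = x (k + t)" if "finite F" "F \<subseteq> X" "finite W" for F W
    using h'[of F W 0] that by (auto simp: f_def subset_iff)
  then have ellis: "f \<in> ellis \<theta>"
    using f_in by (subst ellis_iff) (auto simp: f_def)
  have fib: "f x \<in> fibre \<theta> l z" if x: "x \<in> fibre \<theta> l z" for x z
  proof -
    have xX: "x \<in> X" using x by (simp add: fibre_def)
    have "f x \<in> shift (int (z n)) ` (S ^^ n) ` X" for n
    proof (rule cylinder_closed)
      show "z n < l ^ n" using x by (simp add: fibre_iff)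
      fix N
      obtain y where y: "y \<in> X" "x = shift (int (z n)) ((S ^^ n) y)"
        using x unfolding fibre_iff by blast
      \<comment> \<open>For \<open>m \<ge> n\<close> the shift by \<open>s * l ^ m\<close> is a
        multiple of \<open>l ^ n\<close> and leaves the level \<open>n\<close> residue
        unchanged.\<close>
      obtain m where m: "m \<ge> n" "\<forall>k\<in>{- int N..<int N}. h (x, k) = x (k + s * int (l ^ m))"
        using h'[of "{x}" "{- int N..<int N}" n] by auto
      have "int (l ^ m) = int (l ^ n) * int (l ^ (m - n))"
        using m(1) by (simp flip: power_add)
      then have "shift (s * int (l ^ m)) x
          = shift (int (z n)) ((S ^^ n) (shift (s * int (l ^ (m - n))) y))"
        by (simp add: y(2) subst_seq_pow_shift shift_shift algebra_simps)
      moreover have "f x t = shift (s * int (l ^ m)) x t" if "- int N \<le> t" "t < int N" for t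
        using m(2) that xX by (simp add: f_def shift_def)
      ultimately show "\<exists>w\<in>X. \<forall>t. - int N \<le> t \<longrightarrow> t < int N \<longrightarrow> f x t = shift (int (z n)) ((S ^^ n) w) t"
        using shift_in_subshift[OF y(1)] by metis
    qed
    then show ?thesis
      using x f_in[OF xX] by (simp add: fibre_iff)
  qed
  have "restrict f Z = limit_shift s"
  proof (rule eq_limit_shiftI)
    show "restrict f Z \<in> Z \<rightarrow>\<^sub>E Z" using fib by auto
    fix x assume x: "x \<in> Z"
    obtain n where n: "h (x, - 1) = x (- 1 + s * int (l ^ n))" "h (x, 0) = x (0 + s * int (l ^ n))"
      using h'[of "{x}" "{- 1, 0}" 0] by auto
    \<comment> \<open>A fixed point repeats its letters at \<open>s\<close> and \<open>s - 1\<close>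
      at the edges of the blocks of length \<open>l ^ n\<close>, so the limit is attained at every
      \<open>n\<close>.\<close>
    have "(S ^^ n) x = x"
      by (induction n) (simp_all add: subst_seq_zero_fibre[OF x])
    then have "x (int (l ^ n) * s) = x s" "x (int (l ^ n) * s - 1) = x (s - 1)"
      using subst_seq_pow_block_start[of n x s] subst_seq_pow_block_end[of n x s] by simp_all
    then show "restrict f Z x (- 1) = x (s - 1)" "restrict f Z x 0 = x s"
      using n x zero_fibre_subset by (auto simp: f_def mult.commute)
  qed
  moreover have "f \<in> ellis_fib \<theta> l"
    using ellis fib by (auto simp: ellis_fib_def)
  ultimately show ?thesis
    unfolding ellis_fib0_def by (metis imageI)
qed

text \<open>Since \<open>Z\<close> is finite, one integer \<open>t\<close> realizes \<open>f\<close>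
  at positions \<open>- 1\<close> and \<open>0\<close> on the whole zero fibre; as \<open>f\<close>
  maps \<open>Z\<close> into itself, these two letters determine it there.\<close>

lemma ellis_fib0_eq: "ellis_fib0 \<theta> l = range limit_shift"
proof
  show "ellis_fib0 \<theta> l \<subseteq> range limit_shift"
  proof
    fix h assume "h \<in> ellis_fib0 \<theta> l"
    then obtain f where f: "f \<in> ellis \<theta>" "\<forall>z\<in>l_adic l. f ` fibre \<theta> l z \<subseteq> fibre \<theta> l z" "h = restrict f Z"
      by (auto simp: ellis_fib0_def ellis_fib_def)
    have fZ: "f x \<in> Z" if "x \<in> Z" for x
      using f(2) zero_in_l_adic that by blast
    have "\<exists>t. \<forall>x\<in>Z. \<forall>k\<in>{- 1, 0}. f x k = x (k + t)"
      using conjunct2[OF iffD1[OF ellis_iff f(1)], rule_format,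
          OF finite_zero_fibre zero_fibre_subset, of "{- 1, 0}"] by simp
    then obtain t where "\<forall>x\<in>Z. \<forall>k\<in>{- 1, 0}. f x k = x (k + t)" ..
    then have "h = limit_shift t"
      using fZ by (intro eq_limit_shiftI) (auto simp: f(3))
    then show "h \<in> range limit_shift" by simp
  qed
  show "range limit_shift \<subseteq> ellis_fib0 \<theta> l"
    using limit_shift_in_ellis_fib0 by blast
qed

lemma limit_shift_0: "limit_shift 0 = restrict id Z"
  by (rule sym[OF eq_limit_shiftI]) auto

end

section \<open>The matrix semigroup\<close>

text \<open>The isomorphism is the inverse of \<open>H\<close>; closure and associativity on
  \<open>J\<close> are transported from \<open>T\<close>.\<close>

lemma semigroup_isomorphic_bij:
  assumes "semigroup_on T m'" "bij_betw H T J"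
    and hom: "\<And>x y. x \<in> T \<Longrightarrow> y \<in> T \<Longrightarrow> m (H x) (H y) = H (m' x y)"
  shows "semigroup_isomorphic J m T m'"
proof -
  have H: "\<And>y. y \<in> J \<Longrightarrow> \<exists>x\<in>T. y = H x" "\<And>x. x \<in> T \<Longrightarrow> H x \<in> J"
    using assms(2) by (auto simp: bij_betw_def)
  have cl: "\<And>x y. x \<in> T \<Longrightarrow> y \<in> T \<Longrightarrow> m' x y \<in> T"
    and assoc: "\<And>x y z. x \<in> T \<Longrightarrow> y \<in> T \<Longrightarrow> z \<in> T \<Longrightarrow> m' (m' x y) z = m' x (m' y z)"
    using assms(1) by (auto simp: semigroup_on_def)
  have closed: "m y z \<in> J" if "y \<in> J" "z \<in> J" for y z
    using H(1)[OF that(1)] H(1)[OF that(2)] hom cl H(2) by auto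
  have "m (m y z) w = m y (m z w)" if "y \<in> J" "z \<in> J" "w \<in> J" for y z w
    using H(1)[OF that(1)] H(1)[OF that(2)] H(1)[OF that(3)] by (auto simp: hom cl assoc)
  with closed have "semigroup_on J m"
    by (simp add: semigroup_on_def)
  moreover have "inv_into T H (m y z) = m' (inv_into T H y) (inv_into T H z)"
    if "y \<in> J" "z \<in> J" for y z
    using H(1)[OF that(1)] H(1)[OF that(2)] assms(2)
    by (auto simp: hom cl bij_betw_def inv_into_f_f)
  ultimately show ?thesis
    unfolding semigroup_isomorphic_def using assms(1) bij_betw_inv_into[OF assms(2)] by blast
qed

section \<open>The structure group and the R-set in terms of columns\<close>

context bijective_substitution
begin

definition columns :: "('a \<Rightarrow> 'a) set" where
  "columns = {col \<theta> n i |n i. i < l ^ n}"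

lemma bij_columns: "f \<in> columns \<Longrightarrow> bij f"
  using bij_col by (auto simp: columns_def)

lemma comp_columns:
  assumes "f \<in> columns" "g \<in> columns"
  shows "f \<circ> g \<in> columns"
proof -
  obtain m j n i where *: "j < l ^ m" "f = col \<theta> m j" "i < l ^ n" "g = col \<theta> n i"
    using assms by (auto simp: columns_def)
  show ?thesis
    unfolding columns_def using col_add col_index_less * by (metis (mono_tags, lifting) mem_Collect_eq)
qed

lemma id_columns: "id \<in> columns"
proof -
  have "id = col \<theta> 0 0" by (auto simp: col_0)
  then show ?thesis unfolding columns_def using l_pos(2)[of 0] by blast
qed

text \<open>A column has finite order, so its inverse is one of its powers.\<close>

lemma inv_columns:
  assumes "f \<in> columns"
  shows "inv_into UNIV f \<in> columns"
proof -
  obtain p where p: "0 < p" "f ^^ p = id"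
    using bij_funpow_eq_id[OF bij_columns[OF assms]] .
  have "f ^^ n \<in> columns" for n
  proof (induction n)
    case (Suc n)
    then show ?case unfolding funpow.simps by (rule comp_columns[OF assms])
  qed (simp add: id_columns flip: id_def)
  moreover have "f \<circ> f ^^ (p - 1) = id"
    using p by (metis Suc_diff_1 funpow.simps(2))
  then have "inv_into UNIV f = f ^^ (p - 1)"
    using bij_columns[OF assms] by (metis bij_is_inj comp_assoc comp_id id_comp inj_iff)
  ultimately show ?thesis by simp
qed

lemma Bij_UNIV: "Bij UNIV = {f. bij f}"
  by (auto simp: Bij_def)

lemma mult_structure_group:
  "f \<in> columns \<Longrightarrow> g \<in> columns \<Longrightarrow> f \<otimes>\<^bsub>structure_group \<theta> l\<^esub> g = f \<circ> g"
  by (auto simp: structure_group_def BijGroup_def Bij_UNIV bij_columns compose_def)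

lemma one_structure_group: "\<one>\<^bsub>structure_group \<theta> l\<^esub> = id"
  by (auto simp: structure_group_def BijGroup_def)

text \<open>The columns are already closed under products and inverses, so generating a subgroup
  adds nothing.\<close>

lemma carrier_structure_group: "carrier (structure_group \<theta> l) = columns"
proof -
  have "carrier (BijGroup UNIV) \<inter> columns = columns"
    using bij_columns by (auto simp: BijGroup_def Bij_UNIV)
  then have eq: "carrier (structure_group \<theta> l) = generate (BijGroup UNIV) columns"
    by (simp add: structure_group_def carrier_subgroup_generated columns_def)
  have "f \<in> columns" if "f \<in> generate (BijGroup UNIV) columns" for f
    using that
  proof induction
    case one
    then show ?case using id_columns by (simp add: BijGroup_def id_def)
  next
    case (inv h)
    then have "inv\<^bsub>BijGroup UNIV\<^esub> h = inv_into UNIV h"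
      using inv_BijGroup[of h UNIV] bij_columns by (simp add: Bij_UNIV fun_eq_iff)
    with inv show ?case by (simp add: inv_columns)
  next
    case (eng f g)
    then have "f \<otimes>\<^bsub>BijGroup UNIV\<^esub> g = f \<circ> g"
      using mult_structure_group by (simp add: structure_group_def)
    then show ?case by (simp only: comp_columns[OF eng.IH])
  qed (auto intro: generate.incl)
  then show ?thesis
    unfolding eq by (auto intro: generate.incl)
qed

lemma group_structure_group: "group (structure_group \<theta> l)"
  unfolding structure_group_def by (intro group.group_subgroup_generated group_BijGroup)

lemma inv_structure_group:
  assumes "f \<in> columns"
  shows "inv\<^bsub>structure_group \<theta> l\<^esub> f = inv_into UNIV f"
proof (rule group.inv_equality[OF group_structure_group])
  show "inv_into UNIV f \<otimes>\<^bsub>structure_group \<theta> l\<^esub> f = \<one>\<^bsub>structure_group \<theta> l\<^esub>"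
    using assms bij_columns[OF assms]
    by (simp add: mult_structure_group inv_columns one_structure_group bij_is_inj)
qed (use assms inv_columns in \<open>simp_all add: carrier_structure_group\<close>)

text \<open>The successor form avoids the truncated subtraction \<open>i - 1\<close>.\<close>

lemma R_set_iff:
  "g \<in> R_set \<theta> l \<longleftrightarrow>
     (\<exists>n i. Suc i < l ^ n \<and> g = col \<theta> n (Suc i) \<circ> inv_into UNIV (col \<theta> n i))"
proof
  assume "g \<in> R_set \<theta> l"
  then obtain n i where "1 \<le> i" "i < l ^ n" "g = col \<theta> n i \<circ> inv_into UNIV (col \<theta> n (i - 1))"
    by (auto simp: R_set_def)
  then show "\<exists>n i. Suc i < l ^ n \<and> g = col \<theta> n (Suc i) \<circ> inv_into UNIV (col \<theta> n i)"
    by (intro exI[of _ n] exI[of _ "i - 1"]) simp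
next
  assume "\<exists>n i. Suc i < l ^ n \<and> g = col \<theta> n (Suc i) \<circ> inv_into UNIV (col \<theta> n i)"
  then obtain n i where "Suc i < l ^ n" "g = col \<theta> n (Suc i) \<circ> inv_into UNIV (col \<theta> n i)"
    by blast
  then show "g \<in> R_set \<theta> l"
    unfolding R_set_def by (intro CollectI exI[of _ n] exI[of _ "Suc i"]) simp
qed

lemma R_set_subset: "R_set \<theta> l \<subseteq> columns"
proof
  fix g assume "g \<in> R_set \<theta> l"
  then obtain n i where *: "Suc i < l ^ n" "g = col \<theta> n (Suc i) \<circ> inv_into UNIV (col \<theta> n i)"
    by (auto simp: R_set_iff)
  then have "col \<theta> n (Suc i) \<in> columns" "col \<theta> n i \<in> columns"
    unfolding columns_def using Suc_lessD by blast+
  then show "g \<in> columns"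
    by (simp add: * comp_columns inv_columns)
qed

lemma inv_comp_cancel: "bij g \<Longrightarrow> inv_into UNIV g (g a) = a" "bij g \<Longrightarrow> g (inv_into UNIV g a) = a"
  by (simp_all add: bij_is_inj bij_is_surj surj_f_inv_f)

lemma bij_ex: "bij f \<Longrightarrow> \<exists>a. f a = b"
  by (metis bij_is_surj surjD)

text \<open>Composing the columns that realize \<open>g\<close> with a suitable column on the right corrects the group
  element without changing their quotient.\<close>

lemma R_set_realized:
  assumes "g \<in> R_set \<theta> l" "k \<in> columns"
  obtains m p where "Suc p < l ^ m" "col \<theta> m (Suc p) = k" "col \<theta> m p = inv_into UNIV g \<circ> k"
proof -
  obtain m j where j: "Suc j < l ^ m" "g = col \<theta> m (Suc j) \<circ> inv_into UNIV (col \<theta> m j)"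
    using assms by (auto simp: R_set_iff)
  have col: "col \<theta> m j \<in> columns" "col \<theta> m (Suc j) \<in> columns"
    unfolding columns_def using j(1) Suc_lessD by blast+
  then have "inv_into UNIV (col \<theta> m (Suc j)) \<circ> k \<in> columns"
    using assms(2) by (simp add: inv_columns comp_columns)
  \<comment> \<open>The column \<open>i\<close> of level \<open>n\<close> is the correction that
    turns \<open>col \<theta> m (Suc j)\<close> into \<open>k\<close>.\<close>
  then obtain n i where i: "i < l ^ n" "inv_into UNIV (col \<theta> m (Suc j)) \<circ> k = col \<theta> n i"
    by (auto simp: columns_def)
  \<comment> \<open>Both neighbouring positions lie in the same block \<open>i\<close>, hence
    receive the same right factor.\<close>
  have 1: "Suc (l ^ m * i + j) < l ^ (m + n)"
    using col_index_less[OF i(1) j(1)] by simp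
  have 2: "col \<theta> (m + n) (Suc (l ^ m * i + j)) = k"
    using col_add[OF i(1) j(1)] bij_columns[OF col(2)]
    by (auto simp flip: i(2) simp: inv_comp_cancel)
  have "inv_into UNIV g = col \<theta> m j \<circ> inv_into UNIV (col \<theta> m (Suc j))"
    using bij_columns[OF col(1)] bij_columns[OF col(2)]
    by (simp add: j(2) o_inv_distrib bij_imp_bij_inv inv_inv_eq)
  then have 3: "col \<theta> (m + n) (l ^ m * i + j) = inv_into UNIV g \<circ> k"
    using col_add[OF i(1) Suc_lessD[OF j(1)]] by (simp flip: i(2) add: comp_assoc)
  show thesis using that[OF 1 2 3] .
qed

text \<open>Realizing \<open>g\<close> with second column \<open>id\<close> exhibits the pair inside
  a word generated by \<open>b\<close>.\<close>

lemma allowed_pair_R_set: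
  assumes "g \<in> R_set \<theta> l"
  shows "allowed_pair (inv_into UNIV g b) b"
proof -
  obtain m p where "Suc p < l ^ m" "col \<theta> m (Suc p) = id" "col \<theta> m p = inv_into UNIV g \<circ> id"
    using R_set_realized[OF assms id_columns] .
  then show ?thesis
    unfolding allowed_pair_def by (intro exI[of _ m] exI[of _ p] exI[of _ b]) simp
qed

end

section \<open>The action of the matrix semigroup on the zero fibre\<close>

context simplified_bijective_substitution
begin

context
  fixes g0
  assumes g0: "g0 \<in> R_set \<theta> l"
begin

text \<open>The letter that the image of \<open>x\<close> has at \<open>0\<close>; the R-set
  component then gives the letter at \<open>- 1\<close>. The factor \<open>g0\<close> in the second
  case normalizes the sandwich matrix to \<open>g0\<close> times the inverse of
  \<open>g\<close>.\<close>

fun target :: "('a \<Rightarrow> 'a) \<Rightarrow> sign \<Rightarrow> (int \<Rightarrow> 'a) \<Rightarrow> 'a" where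
  "target k Plus x = k (x 0)"
| "target k Minus x = k (g0 (x (- 1)))"

definition matrix_action :: "('a \<Rightarrow> 'a) \<times> ('a \<Rightarrow> 'a) \<times> sign \<Rightarrow> (int \<Rightarrow> 'a) \<Rightarrow> int \<Rightarrow> 'a" where
  "matrix_action = (\<lambda>(g, k, s).
     restrict (\<lambda>x. point (inv_into UNIV g (target k s x)) (target k s x)) Z)"

lemma target_comp: "target (k \<circ> k') s x = k (target k' s x)"
  by (cases s) auto

abbreviation "G \<equiv> structure_group \<theta> l"
abbreviation "R \<equiv> R_set \<theta> l"
abbreviation "M \<equiv> matrix_carrier G R {Plus, Minus}"
abbreviation "mm \<equiv> matrix_mult G (sandwich G g0)"

lemma M_iff: "(g, k, s) \<in> M \<longleftrightarrow> g \<in> R \<and> k \<in> columns"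
  by (cases s) (auto simp: matrix_carrier_def carrier_structure_group)

lemma bij_g0: "bij g0"
  using g0 R_set_subset bij_columns by blast

lemma bij_R: "g \<in> R \<Longrightarrow> bij g"
  using R_set_subset bij_columns by blast

lemma
  assumes "(g, k, s) \<in> M" "x \<in> Z"
  shows matrix_action_in_zero_fibre: "matrix_action (g, k, s) x \<in> Z"
    and matrix_action_left: "matrix_action (g, k, s) x (- 1) = inv_into UNIV g (target k s x)"
    and matrix_action_right: "matrix_action (g, k, s) x 0 = target k s x"
  using assms allowed_pair_R_set
  by (simp_all add: matrix_action_def M_iff point_in_zero_fibre point_left point_right)

lemma matrix_action_PiE: "e \<in> M \<Longrightarrow> matrix_action e \<in> Z \<rightarrow>\<^sub>E Z"
  using matrix_action_in_zero_fibre by (cases e) (auto simp: matrix_action_def)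

lemma
  assumes "g \<in> R"
  shows sandwich_Minus: "sandwich G g0 Minus g = g0 \<circ> inv_into UNIV g"
    and sandwich_columns: "sandwich G g0 s g \<in> columns"
proof -
  have g: "g \<in> columns" "g0 \<in> columns"
    using assms g0 R_set_subset by auto
  show *: "sandwich G g0 Minus g = g0 \<circ> inv_into UNIV g"
    using g by (simp add: inv_structure_group mult_structure_group inv_columns)
  show "sandwich G g0 s g \<in> columns"
  proof (cases s)
    case Plus
    then show ?thesis by (simp add: one_structure_group id_columns)
  next
    case Minus
    then show ?thesis unfolding Minus * using g by (intro comp_columns inv_columns)
  qed
qed

lemma sandwich_Plus: "sandwich G g0 Plus g = id"
  by (simp add: one_structure_group)

lemma mm_eq:
  assumes "(g, k, s) \<in> M" "(g', k', s') \<in> M"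
  shows "mm (g, k, s) (g', k', s') = (g, k \<circ> sandwich G g0 s g' \<circ> k', s')"
proof -
  have "k \<in> columns" "k' \<in> columns" "sandwich G g0 s g' \<in> columns"
    using assms sandwich_columns by (auto simp only: M_iff)
  then show ?thesis
    by (simp only: matrix_mult_def prod.case mult_structure_group comp_columns)
qed

lemma mm_closed:
  assumes "e \<in> M" "e' \<in> M"
  shows "mm e e' \<in> M"
proof -
  obtain g k s where e_eq: "e = (g, k, s)" by (cases e)
  obtain g' k' s' where e'_eq: "e' = (g', k', s')" by (cases e')
  note M = assms[unfolded e_eq e'_eq]
  have "k \<in> columns" "k' \<in> columns" "sandwich G g0 s g' \<in> columns"
    using M sandwich_columns by (auto simp only: M_iff)
  then have "k \<circ> sandwich G g0 s g' \<circ> k' \<in> columns"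
    by (intro comp_columns)
  with M show ?thesis
    by (simp only: e_eq e'_eq mm_eq[OF M] M_iff)
qed

lemma semigroup_on_M: "semigroup_on M mm"
proof -
  have "mm (mm e e') e'' = mm e (mm e' e'')" if e: "e \<in> M" "e' \<in> M" "e'' \<in> M" for e e' e''
  proof -
    obtain g k s g' k' s' g'' k'' s'' where
      eq: "e = (g, k, s)" "e' = (g', k', s')" "e'' = (g'', k'', s'')"
      by (cases e; cases e'; cases e'') blast
    show ?thesis
      using e mm_closed[OF e(1,2)] mm_closed[OF e(2,3)] unfolding eq
      by (simp only: mm_eq comp_assoc)
  qed
  then show ?thesis
    using mm_closed by (simp add: semigroup_on_def)
qed

text \<open>The outer map reads one central letter of the inner image. For \<open>Plus\<close> this
  is the inner target itself, for \<open>Minus\<close> it is the inverse of \<open>g'\<close> at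
  that target, followed by \<open>g0\<close>; these are the two rows of the sandwich matrix.\<close>

lemma matrix_action_mult:
  assumes "e \<in> M" "e' \<in> M"
  shows "compose Z (matrix_action e) (matrix_action e') = matrix_action (mm e e')"
proof (rule extensionalityI[of _ Z])
  obtain g k s where e_eq: "e = (g, k, s)" by (cases e)
  obtain g' k' s' where e'_eq: "e' = (g', k', s')" by (cases e')
  note eq = e_eq e'_eq
  show "matrix_action (mm e e') \<in> extensional Z"
    using matrix_action_PiE[OF mm_closed[OF assms]] by (simp add: PiE_iff)
  fix x assume x: "x \<in> Z"
  let ?y = "matrix_action (g', k', s') x"
  have e: "(g, k, s) \<in> M" "(g', k', s') \<in> M" "mm (g, k, s) (g', k', s') \<in> M"
    using assms mm_closed eq by auto
  have y: "?y \<in> Z"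
    using matrix_action_in_zero_fibre[OF e(2) x] .
  have "target k s ?y = target (k \<circ> sandwich G g0 s g' \<circ> k') s' x"
    using matrix_action_left[OF e(2) x] matrix_action_right[OF e(2) x] e(2)
    by (cases s) (auto simp: M_iff target_comp sandwich_Minus sandwich_Plus simp del: sandwich.simps)
  then show "compose Z (matrix_action e) (matrix_action e') x = matrix_action (mm e e') x"
    using x y e unfolding eq mm_eq[OF e(1,2)]
    by (simp add: compose_eq matrix_action_def)
qed simp

lemma action_determines:
  assumes "(g, k, s) \<in> M" "(g', k', s') \<in> M"
    and "matrix_action (g, k, s) = matrix_action (g', k', s')"
    and "x \<in> Z"
  shows "target k s x = target k' s' x"
    and "inv_into UNIV g (target k s x) = inv_into UNIV g' (target k s x)"
  using matrix_action_left[OF assms(1,4)] matrix_action_left[OF assms(2,4)]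
    matrix_action_right[OF assms(1,4)] matrix_action_right[OF assms(2,4)] assms(3) by simp_all

lemma letter_left: "\<exists>x\<in>Z. x (- 1) = a"
  using letter_is_first[of a] point_in_zero_fibre point_left by blast

lemma letter_right: "\<exists>x\<in>Z. x 0 = b"
  using letter_is_second[of b] point_in_zero_fibre point_right by blast

lemma target_surj:
  assumes "k \<in> columns"
  shows "\<exists>x\<in>Z. target k s x = c"
proof -
  obtain b where b: "k b = c"
    using bij_ex[OF bij_columns[OF assms]] by blast
  obtain a where a: "g0 a = b"
    using bij_ex[OF bij_g0] by blast
  show ?thesis
  proof (cases s)
    case Plus
    obtain x where "x \<in> Z" "x 0 = b"
      using letter_right by blast
    with b Plus show ?thesis by (intro bexI[of _ x]) simp_all
  next
    case Minus
    obtain x where "x \<in> Z" "x (- 1) = a"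
      using letter_left by blast
    with a b Minus show ?thesis by (intro bexI[of _ x]) simp_all
  qed
qed

text \<open>If the two signs gave the same action, each letter would be a fixed permutation of its left
  neighbour.\<close>

lemma plus_minus_distinct:
  assumes "(g, k, Plus) \<in> M" "(g', k', Minus) \<in> M"
  shows "matrix_action (g, k, Plus) \<noteq> matrix_action (g', k', Minus)"
proof
  assume eq: "matrix_action (g, k, Plus) = matrix_action (g', k', Minus)"
  define c where "c = inv_into UNIV k \<circ> k' \<circ> g0"
  have bij: "bij k" "bij k'"
    using assms bij_columns by (auto simp: M_iff)
  have c: "b = c a" if "allowed_pair a b" for a b
    using action_determines(1)[OF assms eq point_in_zero_fibre[OF that]] bij
    by (simp add: c_def point_left[OF that] point_right[OF that]) (metis inv_comp_cancel(1))
  obtain x where x: "x \<in> Z" using letter_left by blast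
  have "x (q + 1) = c (x q)" for q
    using c allowed_pair_in_subshift x zero_fibre_subset by blast
  moreover have "bij c"
    unfolding c_def using bij bij_g0 by (intro bij_comp bij_imp_bij_inv)
  ultimately show False
    using recurrence_imp_periodic[of c x] aperiodic x zero_fibre_subset by blast
qed

text \<open>Once the signs agree, \<open>g\<close> is recovered from the two central letters of the
  images, as every letter occurs as a target, and \<open>k\<close> from the targets
  themselves.\<close>

lemma inj_matrix_action: "inj_on matrix_action M"
proof (rule inj_onI)
  fix e e' assume e: "e \<in> M" "e' \<in> M" "matrix_action e = matrix_action e'"
  obtain g k s where e_eq: "e = (g, k, s)" by (cases e)
  obtain g' k' s' where e'_eq: "e' = (g', k', s')" by (cases e')
  note eq = e_eq e'_eq
  note * = e[unfolded eq]
  have "s = s'"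
    using * plus_minus_distinct by (cases s; cases s') (auto dest: sym)
  moreover have "inv_into UNIV g c = inv_into UNIV g' c" for c
    using target_surj[of k s c] action_determines(2)[OF *] *(1) by (auto simp: M_iff)
  then have "g = g'"
    using bij_R *(1,2) by (metis M_iff ext inv_inv_eq)
  moreover have "k b = k' b" for b
  proof (cases s)
    case Plus
    obtain x where "x \<in> Z" "x 0 = b" using letter_right by blast
    then show ?thesis
      using action_determines(1)[OF *] Plus \<open>s = s'\<close> by fastforce
  next
    case Minus
    obtain a where a: "g0 a = b" using bij_ex[OF bij_g0] by blast
    obtain x where "x \<in> Z" "x (- 1) = a" using letter_left by blast
    then show ?thesis
      using action_determines(1)[OF *] Minus \<open>s = s'\<close> a by fastforce
  qed
  ultimately show "e = e'" by (auto simp: eq)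
qed

text \<open>The columns \<open>p\<close> and \<open>Suc p\<close> of level \<open>m\<close> occur in
  \<open>x\<close> to the right of the origin, applied to \<open>x 0\<close>, and
  \<open>l ^ m\<close> places further left, applied to \<open>x (- 1)\<close>. In the latter case
  the inverse of \<open>g0\<close> cancels the factor in \<open>target\<close>.\<close>

lemma matrix_action_eq_limit_shift:
  assumes "Suc p < l ^ m"
    and g: "g = col \<theta> m (Suc p) \<circ> inv_into UNIV (col \<theta> m p)"
  shows "(g, col \<theta> m (Suc p), Plus) \<in> M"
    and "matrix_action (g, col \<theta> m (Suc p), Plus) = limit_shift (int (Suc p))"
    and "(g, col \<theta> m (Suc p) \<circ> inv_into UNIV g0, Minus) \<in> M"
    and "matrix_action (g, col \<theta> m (Suc p) \<circ> inv_into UNIV g0, Minus) = limit_shift (int (Suc p) - int (l ^ m))"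
proof -
  have c: "col \<theta> m (Suc p) \<in> columns" "col \<theta> m p \<in> columns"
    unfolding columns_def using assms(1) Suc_lessD by blast+
  have R: "g \<in> R"
    using assms by (auto simp: R_set_iff)
  show M1: "(g, col \<theta> m (Suc p), Plus) \<in> M"
    using R c by (simp add: M_iff)
  show M2: "(g, col \<theta> m (Suc p) \<circ> inv_into UNIV g0, Minus) \<in> M"
    using R c g0 R_set_subset by (auto simp: M_iff inv_columns comp_columns)
  have inv: "inv_into UNIV g (col \<theta> m (Suc p) a) = col \<theta> m p a" for a
    using bij_columns[OF c(1)] bij_columns[OF c(2)]
    by (simp add: g o_inv_distrib bij_imp_bij_inv inv_inv_eq inv_comp_cancel)
  show "matrix_action (g, col \<theta> m (Suc p), Plus) = limit_shift (int (Suc p))"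
  proof (rule eq_limit_shiftI[OF matrix_action_PiE[OF M1]])
    fix x assume x: "x \<in> Z"
    have "x (int p) = col \<theta> m p (x 0)" "x (int (Suc p)) = col \<theta> m (Suc p) (x 0)"
      using zero_fibre_right[OF x] assms(1) Suc_lessD by blast+
    then show "matrix_action (g, col \<theta> m (Suc p), Plus) x (- 1) = x (int (Suc p) - 1)"
      "matrix_action (g, col \<theta> m (Suc p), Plus) x 0 = x (int (Suc p))"
      by (simp_all add: matrix_action_left[OF M1 x] matrix_action_right[OF M1 x] inv)
  qed
  show "matrix_action (g, col \<theta> m (Suc p) \<circ> inv_into UNIV g0, Minus) = limit_shift (int (Suc p) - int (l ^ m))"
  proof (rule eq_limit_shiftI[OF matrix_action_PiE[OF M2]])
    fix x assume x: "x \<in> Z"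
    have t: "target (col \<theta> m (Suc p) \<circ> inv_into UNIV g0) Minus x = col \<theta> m (Suc p) (x (- 1))"
      by (simp add: inv_comp_cancel(1)[OF bij_g0])
    have "x (int p - int (l ^ m)) = col \<theta> m p (x (- 1))"
      and *: "x (int (Suc p) - int (l ^ m)) = col \<theta> m (Suc p) (x (- 1))"
      using zero_fibre_left[OF x] assms(1) Suc_lessD by blast+
    moreover have "int (Suc p) - int (l ^ m) - 1 = int p - int (l ^ m)"
      by simp
    ultimately show "matrix_action (g, col \<theta> m (Suc p) \<circ> inv_into UNIV g0, Minus) x (- 1)
        = x (int (Suc p) - int (l ^ m) - 1)"
      by (simp only: matrix_action_left[OF M2 x] t inv)
    show "matrix_action (g, col \<theta> m (Suc p) \<circ> inv_into UNIV g0, Minus) x 0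
        = x (int (Suc p) - int (l ^ m))"
      by (simp only: matrix_action_right[OF M2 x] t *)
  qed
qed

text \<open>Each triple is realized at some position by \<open>R_set_realized\<close>, and each
  nonzero \<open>s\<close> lies in a window of length \<open>l ^ m\<close> on its side of the
  origin.\<close>

lemma image_matrix_action: "matrix_action ` M = limit_shift ` {s. s \<noteq> 0}"
proof
  show "matrix_action ` M \<subseteq> limit_shift ` {s. s \<noteq> 0}"
  proof
    fix f assume "f \<in> matrix_action ` M"
    then obtain g k s where f: "(g, k, s) \<in> M" "f = matrix_action (g, k, s)" by auto
    then have gk: "g \<in> R" "k \<in> columns" by (auto simp: M_iff)
    have ex: "\<exists>m p. Suc p < l ^ m \<and> col \<theta> m (Suc p) = k'
        \<and> g = col \<theta> m (Suc p) \<circ> inv_into UNIV (col \<theta> m p)" if k': "k' \<in> columns" for k'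
    proof -
      obtain m p where *: "Suc p < l ^ m" "col \<theta> m (Suc p) = k'" "col \<theta> m p = inv_into UNIV g \<circ> k'"
        using R_set_realized[OF gk(1) k'] .
      have "k' \<circ> inv_into UNIV (inv_into UNIV g \<circ> k') = g"
        using bij_R[OF gk(1)] bij_columns[OF k']
        by (auto simp: o_inv_distrib bij_imp_bij_inv inv_inv_eq inv_comp_cancel)
      with * show ?thesis by metis
    qed
    show "f \<in> limit_shift ` {s. s \<noteq> 0}"
    proof (cases s)
      case Plus
      obtain m p where *: "Suc p < l ^ m" "col \<theta> m (Suc p) = k"
        "g = col \<theta> m (Suc p) \<circ> inv_into UNIV (col \<theta> m p)"
        using ex[OF gk(2)] by blast
      then have "f = limit_shift (int (Suc p))"
        using matrix_action_eq_limit_shift(2)[OF *(1,3)] by (simp only: f Plus *(2))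
      then show ?thesis by (rule image_eqI[OF _ CollectI]) simp
    next
      case Minus
      \<comment> \<open>Realizing \<open>k \<circ> g0\<close> instead of \<open>k\<close>
        compensates for the inverse of \<open>g0\<close> in the negative case.\<close>
      have "k \<circ> g0 \<in> columns"
        using gk g0 R_set_subset by (auto intro: comp_columns)
      then obtain m p where *: "Suc p < l ^ m" "col \<theta> m (Suc p) = k \<circ> g0"
        "g = col \<theta> m (Suc p) \<circ> inv_into UNIV (col \<theta> m p)"
        using ex by blast
      have "k \<circ> g0 \<circ> inv_into UNIV g0 = k"
        using bij_g0 by (auto simp: inv_comp_cancel)
      then have "f = limit_shift (int (Suc p) - int (l ^ m))"
        using matrix_action_eq_limit_shift(4)[OF *(1,3)] by (simp only: f Minus *(2))
      moreover have "int (Suc p) - int (l ^ m) \<noteq> 0"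
        using *(1) by linarith
      ultimately show ?thesis by (rule image_eqI[OF _ CollectI])
    qed
  qed
  show "limit_shift ` {s. s \<noteq> 0} \<subseteq> matrix_action ` M"
  proof
    fix f assume "f \<in> limit_shift ` {s. s \<noteq> 0}"
    then obtain s where s: "s \<noteq> 0" "f = limit_shift s" by blast
    \<comment> \<open>Since \<open>m < l ^ m\<close>, this level reaches both \<open>s - 1\<close>
      and \<open>s\<close>. For negative \<open>s\<close> the second column has index
      \<open>l ^ m - m\<close>.\<close>
    define m where "m = nat \<bar>s\<bar>"
    have lt: "m < l ^ m" by (rule less_length_pow)
    show "f \<in> matrix_action ` M"
    proof (cases "0 < s")
      case True
      then have "Suc (m - 1) < l ^ m" "s = int (Suc (m - 1))"
        using lt by (auto simp: m_def)
      then show ?thesis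
        using matrix_action_eq_limit_shift(1,2)[OF _ refl] s(2) by (metis image_eqI)
    next
      case False
      have "Suc (l ^ m - m - 1) < l ^ m"
        using False lt s(1) unfolding m_def by linarith
      moreover have "s = int (Suc (l ^ m - m - 1)) - int (l ^ m)"
        using False lt s(1) unfolding m_def by linarith
      ultimately show ?thesis
        using matrix_action_eq_limit_shift(3,4)[OF _ refl] s(2) by (metis image_eqI)
    qed
  qed
qed

text \<open>The left factor has sign \<open>Plus\<close>, so it sets the first component and
  multiplies by \<open>k'\<close> with trivial sandwich entry; the right factor sets the sign and
  cancels the remaining \<open>w\<close>.\<close>

lemma M_simple:
  assumes "e \<in> M" "e' \<in> M"
  shows "\<exists>u\<in>M. \<exists>v\<in>M. mm (mm u e) v = e'"
proof -
  obtain g k s where e_eq: "e = (g, k, s)" by (cases e)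
  obtain g' k' s' where e'_eq: "e' = (g', k', s')" by (cases e')
  note eq = e_eq e'_eq
  note M = assms[unfolded eq]
  define w where "w = k \<circ> sandwich G g0 s g"
  have w: "w \<in> columns"
    using M by (simp add: w_def M_iff sandwich_columns comp_columns)
  have u: "(g', k', Plus) \<in> M" and v: "(g, inv_into UNIV w, s') \<in> M"
    using M w by (simp_all add: M_iff inv_columns)
  have "k' \<circ> w \<circ> inv_into UNIV w = k'"
    using bij_columns[OF w] by (auto simp: inv_comp_cancel)
  moreover have "mm (mm (g', k', Plus) (g, k, s)) (g, inv_into UNIV w, s')
      = (g', k' \<circ> w \<circ> inv_into UNIV w, s')"
    using mm_eq[OF mm_closed[OF u M(1), unfolded mm_eq[OF u M(1)]] v]
    by (simp add: mm_eq[OF u M(1)] w_def comp_assoc one_structure_group)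
  ultimately show ?thesis
    using u v unfolding eq by metis
qed

text \<open>The semigroup is the image of \<open>M\<close> with the identity adjoined, so the image
  is an ideal. Every ideal meets the image and then contains it by \<open>M_simple\<close>.\<close>

lemma structural_semigroup_eq: "structural_semigroup \<theta> l = matrix_action ` M"
proof -
  define E where "E = ellis_fib0 \<theta> l"
  have E: "E = insert (restrict id Z) (matrix_action ` M)"
    unfolding E_def ellis_fib0_eq image_matrix_action limit_shift_0[symmetric] by auto
  have id: "compose Z (restrict id Z) f = f" "compose Z f (restrict id Z) = f"
    if "f \<in> matrix_action ` M" for f
  proof -
    have "f \<in> Z \<rightarrow>\<^sub>E Z" using that matrix_action_PiE by blast
    then show "compose Z (restrict id Z) f = f" "compose Z f (restrict id Z) = f"
      by (auto simp: compose_def PiE_iff extensional_def fun_eq_iff)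
  qed
  have mult: "compose Z f h \<in> matrix_action ` M"
    if "f \<in> matrix_action ` M" "h \<in> matrix_action ` M" for f h
    using that matrix_action_mult mm_closed by auto
  have ne: "M \<noteq> {}"
    using g0 id_columns M_iff by blast
  have "two_sided_ideal E (compose Z) (matrix_action ` M)"
    unfolding two_sided_ideal_def using id mult ne by (auto simp: E)
  moreover have "matrix_action ` M \<subseteq> J" if J: "two_sided_ideal E (compose Z) J" for J
  proof -
    obtain j where j: "j \<in> J" using J by (auto simp: two_sided_ideal_def)
    obtain e0 where e0: "e0 \<in> M" using ne by blast
    \<comment> \<open>Multiplying by an element of the image moves \<open>j\<close> into the image,
      also when \<open>j\<close> is the identity.\<close>
    have "compose Z j (matrix_action e0) \<in> J"
      using J j e0 by (auto simp: two_sided_ideal_def E)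
    moreover have "compose Z j (matrix_action e0) \<in> matrix_action ` M"
      using J j e0 id mult by (auto simp: two_sided_ideal_def E)
    ultimately obtain e where e: "e \<in> M" "matrix_action e \<in> J" by auto
    have "matrix_action e' \<in> J" if e': "e' \<in> M" for e'
    proof -
      obtain u v where uv: "u \<in> M" "v \<in> M" "mm (mm u e) v = e'"
        using M_simple[OF e(1) e'] by blast
      then have "matrix_action e' = compose Z (compose Z (matrix_action u) (matrix_action e)) (matrix_action v)"
        using e mm_closed by (simp add: matrix_action_mult)
      moreover have "matrix_action u \<in> E" "matrix_action v \<in> E"
        using uv by (auto simp: E)
      ultimately show ?thesis
        using J e(2) unfolding two_sided_ideal_def by simp
    qed
    then show ?thesis by blast
  qed
  ultimately show ?thesis
    unfolding structural_semigroup_def semigroup_kernel_def E_def[symmetric]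
    by (intro Least_equality) auto
qed

lemma structural_semigroup_isomorphic:
  "semigroup_isomorphic (structural_semigroup \<theta> l) (compose Z) M mm"
  unfolding structural_semigroup_eq
  using semigroup_on_M inj_matrix_action matrix_action_mult
  by (intro semigroup_isomorphic_bij[where H = matrix_action]) (auto simp: bij_betw_def)

end

end

theorem theorem4p6:
  fixes \<theta> :: "'a::finite \<Rightarrow> 'a list" and l :: nat and g0 :: "'a \<Rightarrow> 'a"
  assumes "has_length \<theta> l"
    and "primitive_subst \<theta>"
    and "aperiodic_subst \<theta>"
    and "bijective_subst \<theta> l"
    and "simplified_subst \<theta> l"
    and "g0 \<in> R_set \<theta> l"
  shows "semigroup_isomorphic
           (structural_semigroup \<theta> l) (compose (zero_fibre \<theta> l))
           (matrix_carrier (structure_group \<theta> l) (R_set \<theta> l) {Plus, Minus})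
           (matrix_mult (structure_group \<theta> l) (sandwich (structure_group \<theta> l) g0))"
proof -
  \<comment> \<open>An element of the R-set needs a word of level \<open>n\<close> with at least two
    letters, which forces \<open>2 \<le> l\<close>.\<close>
  obtain n i where "1 \<le> i" "i < l ^ n"
    using assms(6) by (auto simp: R_set_def)
  then have "1 < l ^ n" by simp
  then have "2 \<le> l"
    using power_mono[of l 1 n] by (cases "l \<le> 1") simp_all
  then interpret simplified_bijective_substitution \<theta> l
  proof unfold_locales
    show "length (\<theta> a) = l" for a
      using assms(1) by (simp add: has_length_def)
    show "bij (\<lambda>a. \<theta> a ! i)" if "i < l" for i
      using assms(4) that by (simp add: bijective_subst_def)
    show "shift p x \<noteq> x" if "x \<in> subshift \<theta>" "0 < p" for x p
      using assms(3) that by (auto simp: aperiodic_subst_def)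
    show "subst_seq \<theta> l x = x" if "x \<in> subshift \<theta>" "0 < p" "(subst_seq \<theta> l ^^ p) x = x" for x p
      using assms(5) that unfolding simplified_subst_def by blast
    show "b \<in> set (\<theta> a)" for a b
      using assms(5) by (simp add: simplified_subst_def)
  qed
  show ?thesis
    using assms(6) by (rule structural_semigroup_isomorphic)
qed

end
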